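(* Let $\mu$ be a self-similar measure on $\mathbb{R}^d$ of support $K$ and let $\mathcal{B}=(B_n)_{n\in\mathbb{N}}$ be a sequence of balls centered in $K$ satisfying $|B_n|\to0$ and $\mu(\limsup_{n\to+\infty}B_n)=1$. Then, for every $\delta\ge1$, $$\dim_H\Big(\limsup_{n\to+\infty}B_n^\delta\Big)\ge\frac{\dim(\mu)}{\delta}.$$ Assume furthermore that $\mathcal{B}$ is weakly redundant and that $\limsup_{n\to+\infty}\frac{\log\mu(B_n)}{\log|B_n|}=\dim(\mu)$. Then for every $\delta\ge1$, $$\dim_H\Big(\limsup_{n\to+\infty}B_n^\delta\Big)=\frac{\dim(\mu)}{\delta}.$$
   Context: Balls are closed balls $B(x,r)$ ($r>0$) of $(\mathbb{R}^d,\|\cdot\|_\infty)$; $|B|$ is the diameter of $B$. For $B=B(x,r)$, the $\delta$-contracted ball is $B^\delta=B(x,r^\delta)$. For sets $A_n$, $\limsup_{n\to+\infty}A_n=\bigcap_{g}\bigcup_{n\ge g}A_n$. $\dim_H$ of a set is its Hausdorff dimension. Self-similar measure: given a family $S=\{f_i\}_{i=1}^m$ of $m\ge2$ contracting similarities of $\mathbb{R}^d$ and $(p_i)_{i=1}^m\in(0,1)^m$ with $\sum_ip_i=1$, the associated self-similar measure is the unique probability measure $\mu$ with $\mu=\sum_{i=1}^mp_i\,\mu\circ f_i^{-1}$. Its topological support is the attractor $K$ of $S$, the unique non-empty compact set $K\subset\mathbb{R}^d$ with $K=\bigcup_{i=1}^mf_i(K)$. Every self-similar measure is exact dimensional: there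 is a number, denoted $\dim(\mu)$, with $\lim_{r\to0^+}\frac{\log\mu(B(x,r))}{\log r}=\dim(\mu)$ for $\mu$-almost every $x$. A family of balls $\mathcal{B}=(B_n=B(x_n,r_n))_{n\in\mathbb{N}}$ is weakly redundant if, with $\mathcal{T}_k(\mathcal{B})=\{B_n: 2^{-k-1}<r_n\le2^{-k}\}$, for all $k$ there exist an integer $J_k$ and a partition $\mathcal{T}_{k,1}(\mathcal{B}),\dots,\mathcal{T}_{k,J_k}(\mathcal{B})$ of $\mathcal{T}_k(\mathcal{B})$ such that: $\mathcal{T}_k(\mathcal{B})=\bigcup_{1\le j\le J_k}\mathcal{T}_{k,j}(\mathcal{B})$; for every $1\le j\le J_k$ and every pair of balls $B\ne B'$ in $\mathcal{T}_{k,j}(\mathcal{B})$, $B\cap B'=\emptyset$; and $\lim_{k\to+\infty}\frac{\log_2(J_k)}{k}=0$. *)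

theory Defs
  imports "HOL-Probability.Probability"
begin

text \<open>The ambient metric space is \<^typ>\<open>real ^ 'n\<close> with the supremum norm \<^const>\<open>infnorm\<close>: balls,
  diameters and Hausdorff measures below all refer to it (\<^const>\<open>cball\<close> and \<^const>\<open>diameter\<close>
  would be Euclidean).\<close>

definition sup_cball :: "real ^ 'n \<Rightarrow> real \<Rightarrow> (real ^ 'n) set" where
  "sup_cball x r = {y. infnorm (y - x) \<le> r}"

definition sup_diameter :: "(real ^ 'n) set \<Rightarrow> real" where
  "sup_diameter A = (if A = {} then 0 else SUP (x, y) \<in> A \<times> A. infnorm (x - y))"

definition contracted_cball :: "real \<Rightarrow> real ^ 'n \<Rightarrow> real \<Rightarrow> (real ^ 'n) set" where
  "contracted_cball \<delta> x r = sup_cball x (r powr \<delta>)"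

text \<open>Boundedness of the covering sets is required because \<^const>\<open>sup_diameter\<close> is
  meaningless on unbounded sets.\<close>

definition hausdorff_premeasure :: "real \<Rightarrow> real \<Rightarrow> (real ^ 'n) set \<Rightarrow> ennreal" where
  "hausdorff_premeasure s \<epsilon> A =
     Inf {(\<Sum>i. ennreal (sup_diameter (U i) powr s)) | U :: nat \<Rightarrow> (real ^ 'n) set.
            (\<forall>i. bounded (U i) \<and> sup_diameter (U i) \<le> \<epsilon>) \<and> A \<subseteq> (\<Union>i. U i)}"

definition hausdorff_measure :: "real \<Rightarrow> (real ^ 'n) set \<Rightarrow> ennreal" where
  "hausdorff_measure s A = (SUP \<epsilon>\<in>{0<..}. hausdorff_premeasure s \<epsilon> A)"

text \<open>Only exponents \<open>s > 0\<close> are used, so that the convention for \<open>0 powr 0\<close> plays no role;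
  omitting \<open>s = 0\<close> does not change the infimum. The empty set gets dimension 0.\<close>

definition hausdorff_dim :: "(real ^ 'n) set \<Rightarrow> ereal" where
  "hausdorff_dim A = Inf {ereal s | s. 0 < s \<and> hausdorff_measure s A = 0}"

text \<open>Similarities are those of Euclidean space, as is usual for self-similar sets. Every
  similarity for the supremum norm is also one (a scaled signed permutation plus a translation).\<close>

definition contracting_similarity :: "(real ^ 'n \<Rightarrow> real ^ 'n) \<Rightarrow> bool" where
  "contracting_similarity f \<longleftrightarrow>
     (\<exists>c. 0 < c \<and> c < 1 \<and> (\<forall>x y. dist (f x) (f y) = c * dist x y))"

definition self_similar_measure :: "(real ^ 'n) measure \<Rightarrow> bool" where
  "self_similar_measure \<mu> \<longleftrightarrow>
     prob_space \<mu> \<and> sets \<mu> = sets borel \<and>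
     (\<exists>(m :: nat) (f :: nat \<Rightarrow> real ^ 'n \<Rightarrow> real ^ 'n) (p :: nat \<Rightarrow> real).
        2 \<le> m \<and>
        (\<forall>i<m. contracting_similarity (f i)) \<and>
        (\<forall>i<m. 0 < p i \<and> p i < 1) \<and> (\<Sum>i<m. p i) = 1 \<and>
        (\<forall>A\<in>sets borel. measure \<mu> A = (\<Sum>i<m. p i * measure \<mu> (f i -` A))))"

definition topological_support :: "'a::topological_space measure \<Rightarrow> 'a set" where
  "topological_support \<mu> = {x. \<forall>U. open U \<and> x \<in> U \<longrightarrow> 0 < emeasure \<mu> U}"

definition has_exact_dimension :: "(real ^ 'n) measure \<Rightarrow> real \<Rightarrow> bool" where
  "has_exact_dimension \<mu> D \<longleftrightarrow>
     (AE x in \<mu>. ((\<lambda>r. ln (measure \<mu> (sup_cball x r)) / ln r) \<longlongrightarrow> D) (at_right 0))"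

text \<open>The dimension of an exact dimensional measure. The value 0 for other measures only
  makes the function total: every self-similar measure is exact dimensional (Feng and Hu).\<close>

definition measure_dim :: "(real ^ 'n) measure \<Rightarrow> real" where
  "measure_dim \<mu> =
     (if \<exists>D. has_exact_dimension \<mu> D then (THE D. has_exact_dimension \<mu> D) else 0)"

definition dyadic_balls :: "(nat \<Rightarrow> real ^ 'n) \<Rightarrow> (nat \<Rightarrow> real) \<Rightarrow> nat \<Rightarrow> (real ^ 'n) set set" where
  "dyadic_balls x r k =
     {sup_cball (x n) (r n) | n. 2 powr (- real k - 1) < r n \<and> r n \<le> 2 powr (- real k)}"

text \<open>Parts \<open>T k j\<close> may be empty; as \<open>J k \<ge> 1\<close>, this covers an empty family of balls at
  scale \<open>k\<close> while keeping the logarithm of \<open>J k\<close> meaningful.\<close>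

definition weakly_redundant :: "(nat \<Rightarrow> real ^ 'n) \<Rightarrow> (nat \<Rightarrow> real) \<Rightarrow> bool" where
  "weakly_redundant x r \<longleftrightarrow>
     (\<exists>(J :: nat \<Rightarrow> nat) (T :: nat \<Rightarrow> nat \<Rightarrow> (real ^ 'n) set set).
        (\<forall>k. 1 \<le> J k \<and>
             dyadic_balls x r k = (\<Union>j\<in>{1..J k}. T k j) \<and>
             disjoint_family_on (T k) {1..J k} \<and>
             (\<forall>j\<in>{1..J k}. \<forall>B\<in>T k j. \<forall>B'\<in>T k j. B \<noteq> B' \<longrightarrow> B \<inter> B' = {})) \<and>
        (\<lambda>k. log 2 (real (J k)) / real k) \<longlonglongrightarrow> 0)"

end

theory Submission
  imports Defs
begin

text \<open>
  Lower bound. Let \<open>\<mu>\<close> be exact dimensional of dimension \<open>D\<close>; otherwise \<open>measure_dim \<mu> = 0\<close>.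
  Fix \<open>t\<close> with \<open>\<delta> * t < D\<close> and \<open>s\<close> between \<open>\<delta> * t\<close> and \<open>D\<close>. On a set of positive measure, \<open>\<mu>\<close> satisfies
  a uniform Frostman bound of exponent \<open>s\<close>. By self-similarity, every ball of radius \<open>\<rho> \<le> 1\<close> centred in
  the support contains a copy of \<open>\<mu>\<close> of size comparable to \<open>\<rho>\<close> that is absolutely continuous with
  respect to \<open>\<mu>\<close>; pushing the restricted measure forward yields on every such ball a Frostman
  measure with the same constants up to rescaling (\<open>self_similar_frostman\<close>). For this measure
  too, almost every point lies in infinitely many \<open>B n\<close>. Overlaps of the copies play no role.

  No limit measure on a Cantor set is constructed. Instead, given a cover of the limsup set of the
  contracted balls by sets \<open>U i\<close> with small sum of \<open>t\<close>-th powers of the diameters, a nested sequence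
  of contracted balls is chosen such that the sets meeting a ball of radius \<open>\<rho>\<close> have cost at most
  a small multiple of \<open>\<rho> powr t\<close>. The Frostman measure of the current ball and Vitali's covering
  lemma show that a next ball exists (\<open>nested_step\<close>). The common point of these balls lies in
  the limsup set but in no \<open>U i\<close>, a contradiction (\<open>content_lower_bound\<close>).

  Upper bound. For \<open>s > D / \<delta>\<close>, where \<open>D\<close> is now the upper limit in the hypothesis,
  the sum of \<open>(r n powr \<delta>) powr s\<close> over distinct balls of large index
  is finite: eventually
  \<open>\<mu> (B n)\<close> is at least the power \<open>D + \<epsilon>\<close> of the diameter, so in each of the \<open>J k\<close> disjoint
  classes of scale \<open>k\<close> these powers add up to at most 1, and \<open>J k\<close> grows
  subexponentially (\<open>first_occurrences_summable\<close>). Tails of this sum bound the Hausdorff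
  premeasures.
\<close>

section \<open>Comparison of measures through disjoint families\<close>

text \<open>A one-sided comparison of two measures on the members of a family carries over to the unions,
  provided the sets on the larger side are disjoint. Every counting argument below, for the
  lower as for the upper bound, is an instance.\<close>

lemma emeasure_UN_le_transfer:
  fixes G :: "nat set"
  assumes V: "\<And>n. n \<in> G \<Longrightarrow> V n \<in> sets M" and A: "\<And>n. n \<in> G \<Longrightarrow> A n \<in> sets W"
    and disj: "disjoint_family_on A G"
    and le: "\<And>n. n \<in> G \<Longrightarrow> emeasure M (V n) \<le> k * emeasure W (A n)"
  shows "emeasure M (\<Union>n\<in>G. V n) \<le> k * emeasure W (\<Union>n\<in>G. A n)"
proof -
  define V' where "V' n = (if n \<in> G then V n else {})" for n
  define A' where "A' n = (if n \<in> G then A n else {})" for n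
  have "(\<Union>n\<in>G. V n) = (\<Union>n. V' n)" "(\<Union>n\<in>G. A n) = (\<Union>n. A' n)"
    by (auto simp: V'_def A'_def split: if_splits)
  moreover have "emeasure M (\<Union>n. V' n) \<le> (\<Sum>n. emeasure M (V' n))"
    by (rule emeasure_subadditive_countably) (use V in \<open>auto simp: V'_def\<close>)
  moreover have "(\<Sum>n. emeasure M (V' n)) \<le> (\<Sum>n. k * emeasure W (A' n))"
    by (intro suminf_le) (auto simp: V'_def A'_def le)
  moreover have "(\<Sum>n. k * emeasure W (A' n)) = k * (\<Sum>n. emeasure W (A' n))"
    by simp
  moreover have "(\<Sum>n. emeasure W (A' n)) = emeasure W (\<Union>n. A' n)"
    using A disj by (intro suminf_emeasure) (auto simp: A'_def disjoint_family_on_def)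
  ultimately show ?thesis by simp
qed

text \<open>The discrete measure on the naturals with weight \<open>w i\<close> at \<open>i\<close>; negative weights count as 0.
  With \<open>w i = u i powr t\<close> it measures the \<open>t\<close>-dimensional cost of a subfamily of a cover
  by sets of diameter at most \<open>u i\<close>.\<close>

definition weight_measure :: "(nat \<Rightarrow> real) \<Rightarrow> nat measure" where
  "weight_measure w = density (count_space UNIV) (\<lambda>i. ennreal (w i))"

lemma sets_weight_measure [simp]: "sets (weight_measure w) = UNIV"
  by (simp add: weight_measure_def)

lemma space_weight_measure [simp]: "space (weight_measure w) = UNIV"
  by (simp add: weight_measure_def)

lemma emeasure_weight_measure:
  "emeasure (weight_measure w) A = (\<Sum>i. ennreal (w i) * indicator A i)"
  by (simp add: weight_measure_def emeasure_density nn_integral_count_space_nat)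

lemma emeasure_weight_measure_singleton [simp]:
  "emeasure (weight_measure w) {i} = ennreal (w i)"
proof -
  have "(\<Sum>j. ennreal (w j) * indicator {i} j) = (\<Sum>j\<in>{i}. ennreal (w j) * indicator {i} j)"
    by (rule suminf_finite) auto
  then show ?thesis by (simp add: emeasure_weight_measure)
qed

section \<open>Nested balls that avoid a cheap cover\<close>

text \<open>The inductive step of the lower bound. The ball \<open>cball z \<rho>\<close> is good if the sets \<open>U i\<close> that
  meet it have cost below \<open>c * \<rho> powr t\<close>, and the lemma finds a good contracted ball inside it, of
  arbitrarily large index. Suppose there is none. Vitali's covering lemma selects balls with disjoint
  enlargements whose further enlargements cover \<open>m\<close>-almost all of \<open>cball z (\<rho> / 2)\<close>. The
  enlargements around balls met by a large \<open>U i\<close>, one with \<open>u i\<close> at least the radius, lie in a neighbourhood of size comparable to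
  \<open>u i\<close> of that set, so their mass is controlled by the cost of the sets that meet \<open>cball z \<rho>\<close>
  and the choice of \<open>c\<close>. Every other selected ball is met only by small sets; each of these meets
  a single ball, so the costs add up, and \<open>\<delta> * t < s\<close> yields a factor that tends to 0 with the
  radii. Both parts together carry less than the mass \<open>\<kappa>\<close>, a contradiction.\<close>

lemma nested_step:
  fixes m :: "'a::euclidean_space measure" and x :: "nat \<Rightarrow> 'a" and r u :: "nat \<Rightarrow> real"
    and U :: "nat \<Rightarrow> 'a set"
    and t :: real
  defines "W \<equiv> weight_measure (\<lambda>i. u i powr t)"
  assumes m: "sets m = sets borel"
    and full: "emeasure m (- (\<Inter>g. \<Union>n\<in>{g..}. cball (x n) (\<Lambda> * r n))) = 0"
    and mass: "ennreal \<kappa> \<le> emeasure m (cball z (\<rho> / 2))" "0 < \<kappa>"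
    and decay: "\<And>y v. 0 < v \<Longrightarrow> emeasure m (cball y v) \<le> ennreal (C * (v / \<rho>) powr s)"
    and C: "0 < C" and \<rho>: "0 < \<rho>" "\<rho> \<le> 1"
    and exps: "0 < t" "1 \<le> \<delta>" "\<delta> * t < s" and \<Lambda>: "1 \<le> \<Lambda>"
    and r: "\<And>n. 0 < r n" "r \<longlonglongrightarrow> 0"
    and u: "\<And>i. 0 < u i" "\<And>i p q. p \<in> U i \<Longrightarrow> q \<in> U i \<Longrightarrow> dist p q \<le> u i"
    and c: "0 < c" "c \<le> 1" "C * (15 * \<Lambda> + 2) powr s * c \<le> \<kappa> / 4"
    and content: "emeasure W {i. U i \<inter> cball z \<rho> \<noteq> {}} < ennreal (c * \<rho> powr t)"
  shows "\<exists>n\<ge>N. r n \<le> 1 \<and> cball (x n) (r n powr \<delta>) \<subseteq> cball z \<rho> \<and>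
     emeasure W {i. U i \<inter> cball (x n) (r n powr \<delta>) \<noteq> {}} < ennreal (c * (r n powr \<delta>) powr t)"
proof (rule ccontr)
  assume contra: "\<not> ?thesis"
  define I where "I = {i. U i \<inter> cball z \<rho> \<noteq> {}}"
  define E where "E = (\<Inter>g. \<Union>n\<in>{g..}. cball (x n) (\<Lambda> * r n))"
  have t_le: "t \<le> \<delta> * t" using exps mult_right_mono[of 1 \<delta> t] by simp
  have ts: "t \<le> s" using exps t_le by linarith
  \<comment> \<open>a set of diameter bound above \<open>\<rho>\<close> alone would exceed the admitted cost, as \<open>c \<le> 1\<close>\<close>
  have u_le: "u i \<le> \<rho>" if "i \<in> I" for i
  proof -
    have "ennreal (u i powr t) = emeasure W {i}" by (simp add: W_def)
    also have "\<dots> \<le> emeasure W I" using that by (intro emeasure_mono) (auto simp: W_def)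
    also have "\<dots> < ennreal (c * \<rho> powr t)" using content by (simp add: I_def)
    finally have "u i powr t < c * \<rho> powr t" by (simp add: ennreal_less_iff)
    also have "\<dots> \<le> 1 * \<rho> powr t" using c by (intro mult_right_mono) auto
    finally have "u i powr t < \<rho> powr t" by simp
    then show ?thesis
      using powr_mono2[of t \<rho> "u i"] exps \<rho> by linarith
  qed
  define Q where "Q = C * (15 * \<Lambda>) powr s / \<rho> powr s / c"
  have Q0: "0 < Q" using C c \<rho> \<Lambda> by (simp add: Q_def)
  \<comment> \<open>the scale \<open>\<eta>\<close> below which the balls met only by small sets carry mass at most \<open>\<kappa> / 4\<close>\<close>
  obtain \<eta> where \<eta>: "0 < \<eta>" "\<eta> \<le> 1" "\<Lambda> * \<eta> \<le> \<rho> / 4"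
    "Q * \<eta> powr (s - \<delta> * t) * (c * \<rho> powr t) \<le> \<kappa> / 4"
  proof -
    define e1 where "e1 = \<rho> / (4 * \<Lambda>)"
    define e2 where "e2 = (\<kappa> / 4 / (Q * (c * \<rho> powr t))) powr (1 / (s - \<delta> * t))"
    define \<eta> where "\<eta> = min 1 (min e1 e2)"
    have e: "0 < e1" "0 < e2" using mass Q0 c \<rho> \<Lambda> by (auto simp: e1_def e2_def)
    show ?thesis
    proof (rule that[of \<eta>])
      show "0 < \<eta>" "\<eta> \<le> 1" using e by (auto simp: \<eta>_def)
      have "\<Lambda> * \<eta> \<le> \<Lambda> * e1" using \<Lambda> by (intro mult_left_mono) (auto simp: \<eta>_def)
      then show "\<Lambda> * \<eta> \<le> \<rho> / 4" using \<Lambda> by (simp add: e1_def)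
      have "\<eta> powr (s - \<delta> * t) \<le> e2 powr (s - \<delta> * t)"
        using exps \<open>0 < \<eta>\<close> by (intro powr_mono2) (auto simp: \<eta>_def)
      also have "\<dots> = \<kappa> / 4 / (Q * (c * \<rho> powr t))"
        using exps mass Q0 c \<rho> by (simp add: e2_def powr_powr)
      finally show "Q * \<eta> powr (s - \<delta> * t) * (c * \<rho> powr t) \<le> \<kappa> / 4"
        using Q0 c \<rho> by (simp add: field_simps)
    qed
  qed
  have "eventually (\<lambda>n. r n < \<eta>) sequentially"
    using r(2) \<eta>(1) by (rule order_tendstoD)
  then obtain N0 where N0: "\<And>n. n \<ge> N0 \<Longrightarrow> r n < \<eta>"
    by (auto simp: eventually_sequentially)
  define K where "K = {n. n \<ge> max N N0 \<and> dist (x n) z \<le> 3 * \<rho> / 4}"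
  have K\<eta>: "r n < \<eta>" "n \<ge> N" "r n \<le> 1" "\<Lambda> * r n \<le> \<rho> / 4" "r n \<le> \<rho> / 4" "r n powr \<delta> \<le> r n"
    if "n \<in> K" for n
  proof -
    show 1: "r n < \<eta>" and "n \<ge> N" using that N0 by (auto simp: K_def)
    show 2: "r n \<le> 1" using 1 \<eta> by simp
    have "\<Lambda> * r n \<le> \<Lambda> * \<eta>" using \<Lambda> 1 by (intro mult_left_mono) auto
    then show 3: "\<Lambda> * r n \<le> \<rho> / 4" using \<eta> by linarith
    have "1 * r n \<le> \<Lambda> * r n" using \<Lambda> r(1)[of n] by (intro mult_right_mono) auto
    then show "r n \<le> \<rho> / 4" using 3 by simp
    show "r n powr \<delta> \<le> r n"
      using powr_mono'[of 1 \<delta> "r n"] exps r(1)[of n] 2 by simp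
  qed
  have sub: "cball (x n) (r n powr \<delta>) \<subseteq> cball z \<rho>" if "n \<in> K" for n
  proof
    fix y assume "y \<in> cball (x n) (r n powr \<delta>)"
    then have "dist (x n) y \<le> \<rho> / 4" using K\<eta>[OF that] by simp
    moreover have "dist (x n) z \<le> 3 * \<rho> / 4" using that by (simp add: K_def)
    ultimately show "y \<in> cball z \<rho>"
      using dist_triangle[of z y "x n"] by (simp add: dist_commute)
  qed
  define J where "J n = {i. U i \<inter> cball (x n) (r n powr \<delta>) \<noteq> {}}" for n
  have bad: "ennreal (c * (r n powr \<delta>) powr t) \<le> emeasure W (J n)" if "n \<in> K" for n
    using contra K\<eta>[OF that] sub[OF that] by (force simp: J_def not_less)
  have JI: "J n \<subseteq> I" if "n \<in> K" for n
    using sub[OF that] by (auto simp: J_def I_def)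
  \<comment> \<open>the factor 3 leaves room for a small set that meets two of the balls\<close>
  have cover: "E \<inter> cball z (\<rho> / 2) \<subseteq> (\<Union>n\<in>K. cball (x n) (3 * \<Lambda> * r n))"
  proof
    fix y assume y: "y \<in> E \<inter> cball z (\<rho> / 2)"
    then obtain n where n: "n \<ge> max N N0" "y \<in> cball (x n) (\<Lambda> * r n)"
      unfolding E_def by blast
    have "\<Lambda> * r n \<le> \<Lambda> * \<eta>" using \<Lambda> N0[of n] n by (intro mult_left_mono) auto
    then have "dist (x n) y \<le> \<rho> / 4" using n \<eta> by simp
    then have "dist (x n) z \<le> 3 * \<rho> / 4"
      using y dist_triangle[of "x n" z y] by (simp add: dist_commute)
    moreover have "\<Lambda> * r n \<le> 3 * \<Lambda> * r n"
      using \<Lambda> r(1)[of n] by simp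
    ultimately show "y \<in> (\<Union>n\<in>K. cball (x n) (3 * \<Lambda> * r n))"
      using n by (intro UN_I[of n]) (auto simp: K_def)
  qed
  obtain D where D: "D \<subseteq> K"
     "pairwise (\<lambda>i j. disjnt (cball (x i) (3 * \<Lambda> * r i)) (cball (x j) (3 * \<Lambda> * r j))) D"
     "E \<inter> cball z (\<rho> / 2) \<subseteq> (\<Union>i\<in>D. cball (x i) (5 * (3 * \<Lambda> * r i)))"
  proof (rule Vitali_covering_lemma_cballs[OF cover, of 3])
    fix n assume "n \<in> K"
    then have "\<Lambda> * r n \<le> 1" using K\<eta>(4)[of n] \<rho> by linarith
    then show "0 < 3 * \<Lambda> * r n \<and> 3 * \<Lambda> * r n \<le> 3"
      using r(1)[of n] \<Lambda> by simp
  qed blast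
  \<comment> \<open>\<open>G1\<close> collects the selected balls met by a large set, \<open>G2\<close> the remaining ones\<close>
  define G1 where "G1 = {n \<in> D. \<exists>i\<in>J n. r n \<le> u i}"
  define G2 where "G2 = D - G1"
  let ?V = "\<lambda>n. cball (x n) (5 * (3 * \<Lambda> * r n))"
  have G1: "emeasure m (\<Union>n\<in>G1. ?V n) \<le> ennreal (\<kappa> / 4)"
  proof -
    define p where "p i = (SOME q. q \<in> U i)" for i
    have "(\<Union>n\<in>G1. ?V n) \<subseteq> (\<Union>i\<in>I. cball (p i) ((15 * \<Lambda> + 2) * u i))"
    proof
      fix y assume "y \<in> (\<Union>n\<in>G1. ?V n)"
      then obtain n where n: "n \<in> G1" "dist (x n) y \<le> 15 * \<Lambda> * r n" by auto
      then obtain i where i: "i \<in> J n" "r n \<le> u i" and nK: "n \<in> K" using D(1) by (auto simp: G1_def)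
      then obtain q where q: "q \<in> U i" "dist (x n) q \<le> r n powr \<delta>" by (auto simp: J_def)
      have "p i \<in> U i" unfolding p_def using q(1) by (rule someI)
      then have "dist (p i) q \<le> u i" using q u by blast
      moreover have "dist (x n) q \<le> u i" using q K\<eta>(6)[OF nK] i by linarith
      moreover have "15 * \<Lambda> * r n \<le> 15 * \<Lambda> * u i" using i \<Lambda> by (intro mult_left_mono) auto
      ultimately have "dist (p i) y \<le> (15 * \<Lambda> + 2) * u i"
        using n dist_triangle[of "p i" y q] dist_triangle[of q y "x n"]
        by (simp add: dist_commute algebra_simps)
      then show "y \<in> (\<Union>i\<in>I. cball (p i) ((15 * \<Lambda> + 2) * u i))"
        using JI[OF nK] i by auto
    qed
    then have "emeasure m (\<Union>n\<in>G1. ?V n) \<le> emeasure m (\<Union>i\<in>I. cball (p i) ((15 * \<Lambda> + 2) * u i))"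
      by (intro emeasure_mono) (auto simp: m intro!: sets.countable_UN')
    also have "\<dots> \<le> ennreal (C * (15 * \<Lambda> + 2) powr s / \<rho> powr t) * emeasure W (\<Union>i\<in>I. {i})"
    proof (rule emeasure_UN_le_transfer)
      fix i assume i: "i \<in> I"
      let ?L = "15 * \<Lambda> + 2"
      have "emeasure m (cball (p i) (?L * u i)) \<le> ennreal (C * (?L * u i / \<rho>) powr s)"
        using decay u(1)[of i] \<Lambda> by simp
      also have "C * (?L * u i / \<rho>) powr s \<le> C * ?L powr s / \<rho> powr t * u i powr t"
      proof -
        have "(?L * u i / \<rho>) powr s = ?L powr s * (u i / \<rho>) powr s"
          using \<Lambda> \<rho> u(1)[of i] powr_mult[of ?L "u i / \<rho>" s] by simp
        also have "\<dots> \<le> ?L powr s * (u i / \<rho>) powr t"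
          using \<rho> u(1)[of i] u_le[OF i] ts by (intro mult_left_mono powr_mono') auto
        also have "(u i / \<rho>) powr t = u i powr t / \<rho> powr t"
          using \<rho> u(1)[of i] by (simp add: powr_divide)
        finally have "C * (?L * u i / \<rho>) powr s \<le> C * (?L powr s * (u i powr t / \<rho> powr t))"
          using C by (intro mult_left_mono) auto
        then show ?thesis by (simp add: field_simps)
      qed
      also have "ennreal (C * ?L powr s / \<rho> powr t * u i powr t) =
         ennreal (C * ?L powr s / \<rho> powr t) * emeasure W {i}"
        unfolding W_def emeasure_weight_measure_singleton using C by (subst ennreal_mult) auto
      finally show "emeasure m (cball (p i) (?L * u i)) \<le>
         ennreal (C * ?L powr s / \<rho> powr t) * emeasure W {i}"
        by (simp add: ennreal_leI)
    qed (auto simp: m W_def disjoint_family_on_def)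
    also have "\<dots> \<le> ennreal (C * (15 * \<Lambda> + 2) powr s / \<rho> powr t) * ennreal (c * \<rho> powr t)"
      using content by (intro mult_left_mono) (auto simp: I_def)
    also have "\<dots> = ennreal (C * (15 * \<Lambda> + 2) powr s * c)"
      using C c \<rho> by (simp flip: ennreal_mult)
    also have "\<dots> \<le> ennreal (\<kappa> / 4)" using c by (intro ennreal_leI)
    finally show ?thesis .
  qed
  have G2: "emeasure m (\<Union>n\<in>G2. ?V n) \<le> ennreal (\<kappa> / 4)"
  proof -
    have "emeasure m (\<Union>n\<in>G2. ?V n) \<le>
      ennreal (Q * \<eta> powr (s - \<delta> * t)) * emeasure W (\<Union>n\<in>G2. J n)"
    proof (rule emeasure_UN_le_transfer)
      fix n assume "n \<in> G2"
      then have n: "n \<in> K" using D by (auto simp: G2_def)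
      have r0: "0 < r n" by (rule r)
      have "emeasure m (?V n) \<le> ennreal (C * (15 * \<Lambda> * r n / \<rho>) powr s)"
        using decay[of "15 * \<Lambda> * r n"] \<Lambda> r0 by (simp add: mult.assoc)
      also have "C * (15 * \<Lambda> * r n / \<rho>) powr s = Q * r n powr (s - \<delta> * t) * (c * (r n powr \<delta>) powr t)"
      proof -
        have "(15 * \<Lambda> * r n / \<rho>) powr s = (15 * \<Lambda>) powr s * r n powr s / \<rho> powr s"
          using \<Lambda> r0 \<rho> by (simp add: powr_divide powr_mult)
        moreover have "r n powr s = r n powr (s - \<delta> * t) * (r n powr \<delta>) powr t"
          by (simp add: powr_powr flip: powr_add)
        ultimately show ?thesis using c by (simp add: Q_def)
      qed
      also have "\<dots> \<le> Q * \<eta> powr (s - \<delta> * t) * (c * (r n powr \<delta>) powr t)"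
        using exps Q0 c K\<eta>(1)[OF n] r0 by (intro mult_right_mono mult_left_mono powr_mono2) auto
      also have "ennreal \<dots> \<le> ennreal (Q * \<eta> powr (s - \<delta> * t)) * emeasure W (J n)"
        using bad[OF n] Q0 c by (simp add: ennreal_mult mult_left_mono)
      finally show "emeasure m (?V n) \<le> ennreal (Q * \<eta> powr (s - \<delta> * t)) * emeasure W (J n)"
        by (simp add: ennreal_leI)
    next
      show "disjoint_family_on J G2"
        unfolding disjoint_family_on_def
      proof (intro ballI impI, rule ccontr)
        fix n k assume nk: "n \<in> G2" "k \<in> G2" "n \<noteq> k" "J n \<inter> J k \<noteq> {}"
        then obtain i where i: "i \<in> J n" "i \<in> J k" by blast
        have nkD: "n \<in> D" "k \<in> D" "n \<in> K" "k \<in> K" using nk D by (auto simp: G2_def)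
        have ui: "u i < r n" "u i < r k" using nk i by (force simp: G2_def G1_def)+
        obtain p q where p: "p \<in> U i" "dist (x n) p \<le> r n powr \<delta>"
          and q: "q \<in> U i" "dist (x k) q \<le> r k powr \<delta>"
          using i by (auto simp: J_def)
        have "dist p q \<le> u i" using p q u by blast
        \<comment> \<open>a small set meeting two balls has a point in the tripled version of both\<close>
        have "dist (x k) p \<le> dist (x k) q + dist q p" by (rule dist_triangle)
        then have "dist (x k) p \<le> 2 * r k"
          using q ui K\<eta>(6)[OF nkD(4)] \<open>dist p q \<le> u i\<close> by (simp add: dist_commute)
        moreover have "dist (x n) p \<le> r n" using p K\<eta>(6)[OF nkD(3)] by linarith
        moreover have "3 * r j \<le> 3 * \<Lambda> * r j" for j
          using \<Lambda> r(1)[of j] by simp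
        ultimately have "dist (x k) p \<le> 3 * \<Lambda> * r k" "dist (x n) p \<le> 3 * \<Lambda> * r n"
          using r(1)[of n] r(1)[of k] by (smt (verit, best))+
        then have "p \<in> cball (x n) (3 * \<Lambda> * r n) \<inter> cball (x k) (3 * \<Lambda> * r k)" by simp
        moreover have "disjnt (cball (x n) (3 * \<Lambda> * r n)) (cball (x k) (3 * \<Lambda> * r k))"
          using D(2) nkD nk(3) by (auto simp: pairwise_def)
        ultimately show False by (auto simp: disjnt_def)
      qed
    qed (auto simp: m W_def)
    also have "\<dots> \<le> ennreal (Q * \<eta> powr (s - \<delta> * t)) * ennreal (c * \<rho> powr t)"
    proof (rule mult_left_mono)
      have "emeasure W (\<Union>n\<in>G2. J n) \<le> emeasure W I"
        using JI D(1) by (intro emeasure_mono) (auto simp: W_def G2_def)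
      then show "emeasure W (\<Union>n\<in>G2. J n) \<le> ennreal (c * \<rho> powr t)"
        using content by (simp add: I_def)
    qed auto
    also have "\<dots> = ennreal (Q * \<eta> powr (s - \<delta> * t) * (c * \<rho> powr t))"
      using Q0 c by (simp add: ennreal_mult)
    also have "\<dots> \<le> ennreal (\<kappa> / 4)" using \<eta> by (intro ennreal_leI)
    finally show ?thesis .
  qed
  have V: "(\<Union>n\<in>G. ?V n) \<in> sets m" for G
    by (intro sets.countable_UN') (auto simp: m)
  have Em: "E \<in> sets m" unfolding E_def m by measurable
  have "ennreal \<kappa> \<le> emeasure m (cball z (\<rho> / 2))" by (rule mass)
  also have "\<dots> \<le> emeasure m ((\<Union>n\<in>G1. ?V n) \<union> (\<Union>n\<in>G2. ?V n) \<union> - E)"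
  proof (rule emeasure_mono)
    show "cball z (\<rho> / 2) \<subseteq> (\<Union>n\<in>G1. ?V n) \<union> (\<Union>n\<in>G2. ?V n) \<union> - E"
      using D(3) by (auto simp: G2_def)
    show "(\<Union>n\<in>G1. ?V n) \<union> (\<Union>n\<in>G2. ?V n) \<union> - E \<in> sets m"
      using Em sets.compl_sets[OF Em] sets_eq_imp_space_eq[OF m]
      by (intro sets.Un V) (auto simp: Compl_eq_Diff_UNIV)
  qed
  also have "\<dots> \<le> emeasure m (\<Union>n\<in>G1. ?V n) + emeasure m (\<Union>n\<in>G2. ?V n) + emeasure m (- E)"
    using Em sets.compl_sets[OF Em] sets_eq_imp_space_eq[OF m]
    by (intro order.trans[OF emeasure_subadditive] add_mono order.refl emeasure_subadditive sets.Un V)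
      (auto simp: Compl_eq_Diff_UNIV)
  also have "\<dots> \<le> ennreal (\<kappa> / 4) + ennreal (\<kappa> / 4) + 0"
    using G1 G2 full by (intro add_mono) (auto simp: E_def)
  also have "\<dots> = ennreal (\<kappa> / 2)" using mass by (simp flip: ennreal_plus)
  finally show False using mass by simp
qed

text \<open>If every ball centred in \<open>K\<close> carries a Frostman measure of exponent \<open>s\<close>, with constants that
  are uniform after rescaling and with null sets including those of \<open>\<mu>\<close>, and if \<open>\<mu>\<close>-almost every
  point lies in infinitely many of the balls, then the limsup set of the contracted balls has
  positive \<open>t\<close>-dimensional content for every \<open>t\<close> with \<open>\<delta> * t < s\<close>. The bounds \<open>u i\<close> on the
  diameters are positive, so that a singleton cannot be used free of cost.\<close>

lemma content_lower_bound:
  fixes \<mu> :: "'a::euclidean_space measure" and x :: "nat \<Rightarrow> 'a" and r :: "nat \<Rightarrow> real"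
    and K :: "'a set"
  assumes xK: "\<And>n. x n \<in> K" and r: "\<And>n. 0 < r n" "r \<longlonglongrightarrow> 0"
    and full: "emeasure \<mu> (- (\<Inter>g. \<Union>n\<in>{g..}. cball (x n) (\<Lambda> * r n))) = 0"
    and \<kappa>C: "0 < \<kappa>" "0 < C"
    and frostman: "\<And>z \<rho>. z \<in> K \<Longrightarrow> 0 < \<rho> \<Longrightarrow> \<rho> \<le> 1 \<Longrightarrow>
      \<exists>m. sets m = sets borel \<and> (\<forall>A\<in>sets borel. emeasure \<mu> A = 0 \<longrightarrow> emeasure m A = 0) \<and>
          ennreal \<kappa> \<le> emeasure m (cball z (\<rho> / 2)) \<and>
          (\<forall>y v. 0 < v \<longrightarrow> emeasure m (cball y v) \<le> ennreal (C * (v / \<rho>) powr s))"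
    and exps: "0 < t" "1 \<le> \<delta>" "\<delta> * t < s" and \<Lambda>: "1 \<le> \<Lambda>"
  shows "\<exists>c>0. \<forall>(U :: nat \<Rightarrow> 'a set) u. (\<forall>i. 0 < u i) \<longrightarrow> (\<forall>i. \<forall>p\<in>U i. \<forall>q\<in>U i. dist p q \<le> u i) \<longrightarrow>
     (\<Inter>g. \<Union>n\<in>{g..}. cball (x n) (r n powr \<delta>)) \<subseteq> (\<Union>i. U i) \<longrightarrow>
     ennreal c \<le> (\<Sum>i. ennreal (u i powr t))"
proof -
  define M where "M = C * (15 * \<Lambda> + 2) powr s"
  define c where "c = min 1 (\<kappa> / 4 / M)"
  have M0: "0 < M" using \<kappa>C \<Lambda> by (simp add: M_def)
  have c: "0 < c" "c \<le> 1" using M0 \<kappa>C by (auto simp: c_def)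
  have "M * c \<le> M * (\<kappa> / 4 / M)" using M0 by (intro mult_left_mono) (auto simp: c_def)
  then have c3: "C * (15 * \<Lambda> + 2) powr s * c \<le> \<kappa> / 4" unfolding M_def[symmetric] using M0 by simp
  show ?thesis
  proof (intro exI[of _ c] conjI allI impI)
    show "0 < c" by fact
    fix U :: "nat \<Rightarrow> 'a set" and u
    assume u0: "\<forall>i. 0 < u i" and Ud: "\<forall>i. \<forall>p\<in>U i. \<forall>q\<in>U i. dist p q \<le> u i"
      and cov: "(\<Inter>g. \<Union>n\<in>{g..}. cball (x n) (r n powr \<delta>)) \<subseteq> (\<Union>i. U i)"
    define W where "W = weight_measure (\<lambda>i. u i powr t)"
    show "ennreal c \<le> (\<Sum>i. ennreal (u i powr t))"
    proof (rule ccontr)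
      assume "\<not> ?thesis"
      then have small: "emeasure W UNIV < ennreal c"
        by (simp add: W_def emeasure_weight_measure not_le)
      have step: "\<exists>n\<ge>N. r n \<le> 1 \<and> cball (x n) (r n powr \<delta>) \<subseteq> cball z \<rho> \<and>
         emeasure W {i. U i \<inter> cball (x n) (r n powr \<delta>) \<noteq> {}} < ennreal (c * (r n powr \<delta>) powr t)"
        if z: "z \<in> K" and \<rho>: "0 < \<rho>" "\<rho> \<le> 1"
          and content: "emeasure W {i. U i \<inter> cball z \<rho> \<noteq> {}} < ennreal (c * \<rho> powr t)" for N z \<rho>
      proof -
        obtain m where m: "sets m = sets borel" "\<And>A. A \<in> sets borel \<Longrightarrow> emeasure \<mu> A = 0 \<Longrightarrow> emeasure m A = 0"
          "ennreal \<kappa> \<le> emeasure m (cball z (\<rho> / 2))"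
          "\<And>y v. 0 < v \<Longrightarrow> emeasure m (cball y v) \<le> ennreal (C * (v / \<rho>) powr s)"
          using frostman[OF z \<rho>] by blast
        have "emeasure m (- (\<Inter>g. \<Union>n\<in>{g..}. cball (x n) (\<Lambda> * r n))) = 0"
          using full by (intro m(2)) measurable
        then show ?thesis
          unfolding W_def
          by (rule nested_step[OF m(1) _ m(3) \<kappa>C(1) m(4) \<kappa>C(2) \<rho> exps \<Lambda> r _ _ c c3])
            (use u0 Ud content in \<open>auto simp: W_def\<close>)
      qed
      \<comment> \<open>a cheap cover leaves a nested sequence of good balls, whose common point is not covered\<close>
      define P where "P n \<longleftrightarrow> r n \<le> 1 \<and>
         emeasure W {i. U i \<inter> cball (x n) (r n powr \<delta>) \<noteq> {}} < ennreal (c * (r n powr \<delta>) powr t)" for n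
      have "\<exists>n. \<forall>k. P (n k) \<and> (n k < n (Suc k) \<and>
          cball (x (n (Suc k))) (r (n (Suc k)) powr \<delta>) \<subseteq> cball (x (n k)) (r (n k) powr \<delta>))"
      proof (rule dependent_nat_choice)
        have "emeasure W {i. U i \<inter> cball (x 0) 1 \<noteq> {}} \<le> emeasure W UNIV"
          by (intro emeasure_mono) (auto simp: W_def)
        also note small
        finally show "\<exists>n. P n" using step[of "x 0" 1 0] xK by (auto simp: P_def)
        fix n assume "P n"
        moreover from this have "r n powr \<delta> \<le> 1"
          using r(1)[of n] exps by (intro powr_le1) (auto simp: P_def less_imp_le)
        ultimately show "\<exists>n'. P n' \<and> (n < n' \<and> cball (x n') (r n' powr \<delta>) \<subseteq> cball (x n) (r n powr \<delta>))"
          using step[of "x n" "r n powr \<delta>" "Suc n"] xK r(1)[of n] by (auto simp: P_def Suc_le_eq)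
      qed
      then obtain n where n: "\<And>k. P (n k)" "\<And>k. n k < n (Suc k)"
        "\<And>k. cball (x (n (Suc k))) (r (n (Suc k)) powr \<delta>) \<subseteq> cball (x (n k)) (r (n k) powr \<delta>)"
        by blast
      define F where "F k = cball (x (n k)) (r (n k) powr \<delta>)" for k
      have "\<Inter>(range F) \<noteq> {}"
      proof (rule compact_nest)
        show "F k \<noteq> {}" for k using r(1)[of "n k"] by (simp add: F_def)
        show "F k' \<subseteq> F k" if "k \<le> k'" for k k'
          using lift_Suc_antimono_le[of F] n(3) that by (simp add: F_def)
      qed (simp add: F_def)
      then obtain z where z: "\<And>k. z \<in> F k" by blast
      have sm: "strict_mono n" using n(2) by (simp add: strict_mono_Suc_iff)
      have "z \<in> (\<Inter>g. \<Union>n\<in>{g..}. cball (x n) (r n powr \<delta>))"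
        using z seq_suble[OF sm] by (fastforce simp: F_def)
      with cov obtain i where i: "z \<in> U i" by blast
      have "u i \<le> r (n k)" for k
      proof -
        have "ennreal (u i powr t) = emeasure W {i}" by (simp add: W_def)
        also have "\<dots> \<le> emeasure W {i. U i \<inter> cball (x (n k)) (r (n k) powr \<delta>) \<noteq> {}}"
          using i z[of k] by (intro emeasure_mono) (auto simp: W_def F_def)
        also have "\<dots> < ennreal (c * (r (n k) powr \<delta>) powr t)"
          using n(1)[of k] by (simp add: P_def)
        finally have "u i powr t < c * (r (n k) powr \<delta>) powr t" by (simp add: ennreal_less_iff)
        also have "\<dots> \<le> 1 * (r (n k) powr \<delta>) powr t" using c by (intro mult_right_mono) auto
        finally have "u i < r (n k) powr \<delta>"
          using powr_mono2[of t "r (n k) powr \<delta>" "u i"] exps by (smt (verit) powr_ge_zero)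
        also have "\<dots> \<le> r (n k)"
          using powr_mono'[of 1 \<delta> "r (n k)"] exps r(1)[of "n k"] n(1)[of k] by (simp add: P_def)
        finally show ?thesis by simp
      qed
      moreover have "(\<lambda>k. r (n k)) \<longlonglongrightarrow> 0"
        using LIMSEQ_subseq_LIMSEQ[OF r(2) sm] by (simp add: comp_def)
      ultimately have "u i \<le> 0" by (intro LIMSEQ_le_const) auto
      with u0 show False by (metis not_le)
    qed
  qed
qed

section \<open>Balls and diameters in the supremum norm\<close>

lemma cball_subset_sup_cball: "cball x r \<subseteq> sup_cball x r"
proof
  fix y assume "y \<in> cball x r"
  then show "y \<in> sup_cball x r"
    using infnorm_le_norm[of "y - x"] by (simp add: sup_cball_def dist_norm norm_minus_commute)
qed

lemma sup_cball_subset_cball: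
  "sup_cball (x :: real ^ 'n) r \<subseteq> cball x (sqrt (CARD('n)) * r)"
proof
  fix y assume "y \<in> sup_cball x r"
  have "norm (y - x) \<le> sqrt (CARD('n)) * infnorm (y - x)"
    using norm_le_infnorm[of "y - x"] by simp
  also have "\<dots> \<le> sqrt (CARD('n)) * r"
    using \<open>y \<in> sup_cball x r\<close> by (intro mult_left_mono) (auto simp: sup_cball_def)
  finally show "y \<in> cball x (sqrt (CARD('n)) * r)"
    by (simp add: dist_norm norm_minus_commute)
qed

lemma closed_sup_cball: "closed (sup_cball x r)"
  unfolding sup_cball_def
  by (intro closed_Collect_le continuous_intros)

lemma sup_cball_borel [measurable]: "sup_cball x r \<in> sets borel"
  by (intro borel_closed closed_sup_cball)

lemma sup_cball_triangle:
  assumes "infnorm (x - y) \<le> e" shows "sup_cball x r \<subseteq> sup_cball y (r + e)"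
proof
  fix w assume "w \<in> sup_cball x r"
  then show "w \<in> sup_cball y (r + e)"
    using assms infnorm_triangle[of "w - x" "x - y"] by (simp add: sup_cball_def)
qed

lemma infnorm_le_sup_diameter:
  assumes "bounded U" "p \<in> U" "q \<in> U"
  shows "infnorm (p - q) \<le> sup_diameter U"
proof -
  have "bdd_above ((\<lambda>(x, y). infnorm (x - y)) ` (U \<times> U))"
  proof (rule bdd_aboveI2)
    fix z assume "z \<in> U \<times> U"
    then show "(case z of (x, y) \<Rightarrow> infnorm (x - y)) \<le> diameter U"
      using diameter_bounded_bound[OF assms(1), of "fst z" "snd z"] infnorm_le_norm[of "fst z - snd z"]
      by (auto simp: dist_norm split: prod.split)
  qed
  then have "(case (p, q) of (x, y) \<Rightarrow> infnorm (x - y)) \<le> (SUP (x, y) \<in> U \<times> U. infnorm (x - y))"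
    using assms by (intro cSUP_upper) auto
  then show ?thesis using assms by (auto simp: sup_diameter_def)
qed

lemma bounded_sup_cball: "bounded (sup_cball x r)"
  by (rule bounded_subset[OF bounded_cball sup_cball_subset_cball])

lemma sup_diameter_nonneg:
  assumes "bounded U" shows "0 \<le> sup_diameter U"
proof (cases "U = {}")
  case False
  then obtain p where "p \<in> U" by blast
  then have "infnorm (p - p) \<le> sup_diameter U" using assms by (intro infnorm_le_sup_diameter)
  then show ?thesis by (simp add: infnorm_0)
qed (simp add: sup_diameter_def)

lemma sup_diameter_sup_cball:
  fixes x :: "real ^ 'n"
  assumes "0 \<le> r"
  shows "sup_diameter (sup_cball x r) = 2 * r"
proof (rule antisym)
  have x: "x \<in> sup_cball x r" using assms by (simp add: sup_cball_def infnorm_0)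
  have "infnorm (y - z) \<le> 2 * r" if "y \<in> sup_cball x r" "z \<in> sup_cball x r" for y z
    using that infnorm_triangle[of "y - x" "x - z"] infnorm_sub[of x z] by (simp add: sup_cball_def)
  then show "sup_diameter (sup_cball x r) \<le> 2 * r"
    using x unfolding sup_diameter_def by (auto intro!: cSUP_least)
  define v :: "real ^ 'n" where "v = (\<chi> i. r)"
  have v: "infnorm (c *\<^sub>R v) = c * r" if "0 \<le> c" for c
  proof -
    have "{\<bar>(c *\<^sub>R v) $ i\<bar> |i. i \<in> UNIV} = {c * r}"
      using assms that by (auto simp: v_def)
    then show ?thesis by (simp add: infnorm_cart)
  qed
  have "x + v \<in> sup_cball x r" "x - v \<in> sup_cball x r"
    using v[of 1] by (simp_all add: sup_cball_def infnorm_neg)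
  then have "infnorm ((x + v) - (x - v)) \<le> sup_diameter (sup_cball x r)"
    by (intro infnorm_le_sup_diameter bounded_sup_cball)
  also have "(x + v) - (x - v) = 2 *\<^sub>R v" by (simp add: scaleR_2)
  finally show "2 * r \<le> sup_diameter (sup_cball x r)" using v[of 2] by simp
qed

lemma sup_cball_inject:
  assumes "0 < r" "0 < r'" "sup_cball x r = sup_cball y r'"
  shows "x = y \<and> r = r'"
proof
  show r: "r = r'" using assms sup_diameter_sup_cball[of r x] sup_diameter_sup_cball[of r' y] by simp
  show "x = y"
  proof (rule ccontr)
    assume "x \<noteq> y"
    define d where "d = infnorm (x - y)"
    have d: "0 < d" using \<open>x \<noteq> y\<close> by (simp add: d_def infnorm_pos_lt)
    define w where "w = x + (r / d) *\<^sub>R (x - y)"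
    have "infnorm (w - x) = r" using d assms by (simp add: w_def infnorm_mul d_def)
    then have "w \<in> sup_cball y r" using assms r by (auto simp: sup_cball_def)
    moreover have "w - y = (1 + r / d) *\<^sub>R (x - y)" by (simp add: w_def algebra_simps)
    then have "infnorm (w - y) = (1 + r / d) * d"
      using d assms by (simp add: infnorm_mul d_def)
    then have "infnorm (w - y) = d + r" using d by (simp add: distrib_right)
    ultimately show False using d by (simp add: sup_cball_def)
  qed
qed

section \<open>Frostman measures on copies of a self-similar measure\<close>

lemma self_similar_measureE:
  fixes \<mu> :: "(real ^ 'n) measure"
  assumes "self_similar_measure \<mu>"
  obtains m :: nat and f :: "nat \<Rightarrow> real ^ 'n \<Rightarrow> real ^ 'n" and p c :: "nat \<Rightarrow> real" and a b :: real
  where "prob_space \<mu>" "sets \<mu> = sets borel" "\<And>i. i < m \<Longrightarrow> 0 < p i" "(\<Sum>i<m. p i) = 1"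
    "\<And>i x y. i < m \<Longrightarrow> dist (f i x) (f i y) = c i * dist x y"
    "\<And>A. A \<in> sets borel \<Longrightarrow> measure \<mu> A = (\<Sum>i<m. p i * measure \<mu> (f i -` A))"
    "0 < a" "b < 1" "\<And>i. i < m \<Longrightarrow> a \<le> c i" "\<And>i. i < m \<Longrightarrow> c i \<le> b"
proof -
  obtain m :: nat and f :: "nat \<Rightarrow> real ^ 'n \<Rightarrow> real ^ 'n" and p where *:
    "prob_space \<mu>" "sets \<mu> = sets borel" "2 \<le> m"
    "\<And>i. i < m \<Longrightarrow> contracting_similarity (f i)"
    "\<And>i. i < m \<Longrightarrow> 0 < p i \<and> p i < 1" "(\<Sum>i<m. p i) = 1"
    "\<And>A. A \<in> sets borel \<Longrightarrow> measure \<mu> A = (\<Sum>i<m. p i * measure \<mu> (f i -` A))"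
    using assms unfolding self_similar_measure_def by blast
  define c where "c i = (SOME c. 0 < c \<and> c < 1 \<and> (\<forall>x y. dist (f i x) (f i y) = c * dist x y))" for i
  have c: "0 < c i \<and> c i < 1 \<and> (\<forall>x y. dist (f i x) (f i y) = c i * dist x y)" if "i < m" for i
    using *(4)[OF that] unfolding c_def contracting_similarity_def by (rule someI_ex)
  have ne: "c ` {..<m} \<noteq> {}" using *(3) by (auto simp: lessThan_empty_iff)
  show ?thesis
  proof (rule that[of m p f c "Min (c ` {..<m})" "Max (c ` {..<m})"])
    show "0 < Min (c ` {..<m})" using ne c by (subst Min_gr_iff) auto
    show "Max (c ` {..<m}) < 1" using ne c by (subst Max_less_iff) auto
  qed (use * c in auto)
qed

lemma similarity_measurable:
  fixes f :: "'a::euclidean_space \<Rightarrow> 'a"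
  assumes "\<And>x y. dist (f x) (f y) = c * dist x y"
  shows "f \<in> borel_measurable borel"
proof -
  have "c-lipschitz_on UNIV f" if "0 \<le> c"
    using assms that by (intro lipschitz_onI) auto
  moreover have "0 \<le> c"
  proof -
    obtain b :: 'a where "b \<in> Basis" using nonempty_Basis by blast
    then have "dist (f b) (f 0) = c" using assms[of b 0] by (simp add: norm_Basis)
    then show ?thesis by (metis zero_le_dist)
  qed
  ultimately have "continuous_on UNIV f" by (blast intro: lipschitz_on_continuous_on)
  then show ?thesis by (rule borel_measurable_continuous_onI)
qed

text \<open>With \<open>d\<close> at least all \<open>norm (f i 0)\<close> and all ratios at most \<open>b < 1\<close>, every map sends
  \<open>cball 0 R\<close> into \<open>cball 0 (b * R + d)\<close>, so the invariance of \<open>\<mu>\<close> shows that the second ball has at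
  least the mass of the first. Iterating moves all mass to a fixed ball.\<close>

lemma self_similar_bounded:
  fixes \<mu> :: "(real ^ 'n) measure"
  assumes "self_similar_measure \<mu>"
  obtains R where "0 < R" "measure \<mu> (cball 0 R) = 1"
proof -
  from assms obtain m :: nat and f :: "nat \<Rightarrow> real ^ 'n \<Rightarrow> real ^ 'n" and p c a b
    where \<mu>: "prob_space \<mu>" and sets: "sets \<mu> = sets borel" and p: "\<And>i. i < m \<Longrightarrow> 0 < p i" "(\<Sum>i<m. p i) = 1"
    and f: "\<And>i x y. i < m \<Longrightarrow> dist (f i x) (f i y) = c i * dist x y"
    and inv: "\<And>A. A \<in> sets borel \<Longrightarrow> measure \<mu> A = (\<Sum>i<m. p i * measure \<mu> (f i -` A))"
    and ab: "0 < a" "b < 1" "\<And>i. i < m \<Longrightarrow> a \<le> c i" "\<And>i. i < m \<Longrightarrow> c i \<le> b"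
    by (rule self_similar_measureE) blast
  interpret prob_space \<mu> by fact
  have sp: "space \<mu> = UNIV" using sets_eq_imp_space_eq[OF sets] by simp
  have "m \<noteq> 0" using p(2) by (intro notI) simp
  then have "0 < b" using ab(1) ab(3)[of 0] ab(4)[of 0] by simp
  define d where "d = 1 + (\<Sum>i<m. norm (f i 0))"
  have fd: "norm (f i 0) \<le> d" if "i < m" for i
    using member_le_sum[of i "{..<m}" "\<lambda>i. norm (f i 0)"] that by (simp add: d_def)
  have d0: "0 < d" unfolding d_def by (intro add_pos_nonneg sum_nonneg) auto
  define h where "h R = measure \<mu> (cball 0 R)" for R
  have h_step: "h R \<le> h (b * R + d)" if "0 \<le> R" for R
  proof -
    have "h R = (\<Sum>i<m. p i * h R)" using p(2) by (simp flip: sum_distrib_right)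
    also have "\<dots> \<le> (\<Sum>i<m. p i * measure \<mu> (f i -` cball 0 (b * R + d)))"
    proof (intro sum_mono mult_left_mono)
      fix i assume i: "i \<in> {..<m}"
      show "h R \<le> measure \<mu> (f i -` cball 0 (b * R + d))"
        unfolding h_def
      proof (rule finite_measure_mono)
        show "cball 0 R \<subseteq> f i -` cball 0 (b * R + d)"
        proof
          fix y :: "real ^ 'n" assume "y \<in> cball 0 R"
          then have "dist (f i y) (f i 0) \<le> b * R"
            using f[of i y 0] i ab(4)[of i] \<open>0 < b\<close> by (auto intro!: mult_mono)
          then show "y \<in> f i -` cball 0 (b * R + d)"
            using fd[of i] i norm_triangle_sub[of "f i y" "f i 0"] by (simp add: dist_norm)
        qed
        show "f i -` cball 0 (b * R + d) \<in> sets \<mu>"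
          using measurable_sets[OF similarity_measurable[of "f i" "c i"], of "cball 0 (b * R + d)"] f i
          by (simp add: sets)
      qed
    qed (use p(1) in \<open>auto intro: less_imp_le\<close>)
    also have "\<dots> = h (b * R + d)" unfolding h_def by (rule inv[symmetric]) simp
    finally show ?thesis .
  qed
  define R1 where "R1 = d / (1 - b) + 1"
  have R1: "0 < R1" using d0 ab by (simp add: R1_def add_pos_pos)
  have h_le: "h R \<le> h (d / (1 - b) + b ^ k * R)" if "0 \<le> R" for R k
  proof (induction k)
    case 0
    have "0 \<le> d / (1 - b)" using d0 ab by simp
    then have "cball 0 R \<subseteq> cball (0 :: real ^ 'n) (d / (1 - b) + R)" by (intro cball_subset_cball_iff[THEN iffD2]) simp
    then show ?case by (auto simp: h_def sets intro!: finite_measure_mono)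
  next
    case (Suc k)
    also have "h (d / (1 - b) + b ^ k * R) \<le> h (b * (d / (1 - b) + b ^ k * R) + d)"
      using that d0 ab \<open>0 < b\<close> by (intro h_step) auto
    also have "b * (d / (1 - b) + b ^ k * R) + d = d / (1 - b) + b ^ Suc k * R"
      using ab by (simp add: field_simps)
    finally show ?case .
  qed
  have h_R1: "h R \<le> h R1" if "0 \<le> R" for R
  proof -
    have "(\<lambda>k. b ^ k * R) \<longlonglongrightarrow> 0 * R"
      using \<open>0 < b\<close> ab by (intro tendsto_mult LIMSEQ_power_zero tendsto_const) auto
    then have "eventually (\<lambda>k. b ^ k * R < 1) sequentially"
      by (intro order_tendstoD) auto
    then obtain k where "b ^ k * R < 1" by (auto simp: eventually_sequentially)
    then have "h (d / (1 - b) + b ^ k * R) \<le> h R1"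
      unfolding h_def by (intro finite_measure_mono) (auto simp: R1_def sets)
    with h_le[OF that, of k] show ?thesis by linarith
  qed
  have "(\<lambda>k. measure \<mu> (cball 0 (real k))) \<longlonglongrightarrow> measure \<mu> (\<Union>k. cball 0 (real k))"
    by (intro finite_Lim_measure_incseq) (auto simp: sets incseq_def)
  moreover have "(\<Union>k. cball (0 :: real ^ 'n) (real k)) = UNIV"
    using real_arch_simple by (auto simp: dist_norm)
  ultimately have "(\<lambda>k. h (real k)) \<longlonglongrightarrow> 1"
    using prob_space sp by (simp add: h_def)
  then have "1 \<le> h R1" by (rule LIMSEQ_le_const2) (use h_R1 in auto)
  then show ?thesis using that[of R1] R1 prob_le_1[of "cball 0 R1"] by (simp add: h_def)
qed

text \<open>Every ball of radius at most 1 centred in the support contains almost all of an image of \<open>\<mu>\<close> under a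
  similarity \<open>g\<close> whose ratio is at least proportional to the radius, and this image is absolutely
  continuous with respect to \<open>\<mu>\<close>: preimages of \<open>\<mu>\<close>-null sets are \<open>\<mu>\<close>-null. The map \<open>g\<close> is a composition
  of maps \<open>f i\<close>, built by adding one map at a time on the inside; by invariance, one of the
  extensions still gives positive mass to the ball. No separation of the pieces is needed.\<close>

lemma self_similar_copy:
  fixes \<mu> :: "(real ^ 'n) measure"
  assumes "self_similar_measure \<mu>"
  obtains a0 where "0 < a0" "\<And>z \<rho>. z \<in> topological_support \<mu> \<Longrightarrow> 0 < \<rho> \<Longrightarrow> \<rho> \<le> 1 \<Longrightarrow>
    \<exists>g q. a0 * \<rho> \<le> q \<and> (\<forall>x y. dist (g x) (g y) = q * dist x y) \<and>
      (\<forall>A\<in>sets borel. measure \<mu> A = 0 \<longrightarrow> measure \<mu> (g -` A) = 0) \<and>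
      measure \<mu> (g -` cball z (\<rho> / 2)) = 1"
proof -
  from assms obtain m :: nat and f :: "nat \<Rightarrow> real ^ 'n \<Rightarrow> real ^ 'n" and p c a b
    where \<mu>: "prob_space \<mu>" and sets: "sets \<mu> = sets borel" and p: "\<And>i. i < m \<Longrightarrow> 0 < p i" "(\<Sum>i<m. p i) = 1"
    and f: "\<And>i x y. i < m \<Longrightarrow> dist (f i x) (f i y) = c i * dist x y"
    and inv: "\<And>A. A \<in> sets borel \<Longrightarrow> measure \<mu> A = (\<Sum>i<m. p i * measure \<mu> (f i -` A))"
    and ab: "0 < a" "b < 1" "\<And>i. i < m \<Longrightarrow> a \<le> c i" "\<And>i. i < m \<Longrightarrow> c i \<le> b"
    by (rule self_similar_measureE) blast
  interpret prob_space \<mu> by fact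
  obtain R where R: "0 < R" "measure \<mu> (cball 0 R) = 1" by (rule self_similar_bounded[OF assms])
  have sp: "space \<mu> = UNIV" using sets_eq_imp_space_eq[OF sets] by simp
  have "m \<noteq> 0" using p(2) by (intro notI) simp
  then have "0 < b" using ab(1) ab(3)[of 0] ab(4)[of 0] by simp
  show ?thesis
  proof (rule that[of "a / (8 * R + 1)"])
    show "0 < a / (8 * R + 1)" using ab R by simp
    fix z \<rho> assume z: "z \<in> topological_support \<mu>" and \<rho>: "0 < \<rho>" "\<rho> \<le> (1 :: real)"
    define B where "B = ball z (\<rho> / 4)"
    \<comment> \<open>a copy of ratio at most \<open>\<rho>'\<close> of \<open>cball 0 R\<close> has diameter below \<open>\<rho> / 4\<close>\<close>
    define \<rho>' where "\<rho>' = \<rho> / (8 * R + 1)"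
    have \<rho>': "0 < \<rho>'" "\<rho>' < 1" using \<rho> R by (auto simp: \<rho>'_def)
    define good where "good g q \<longleftrightarrow> (\<forall>x y. dist (g x) (g y) = q * dist x y) \<and>
      (\<forall>A\<in>sets borel. measure \<mu> A = 0 \<longrightarrow> measure \<mu> (g -` A) = 0) \<and> 0 < measure \<mu> (g -` B)"
      for g :: "real ^ 'n \<Rightarrow> real ^ 'n" and q
    have vim: "h -` A \<in> sets borel" if "\<forall>x y. dist (h x) (h y) = q * dist x y" "A \<in> sets borel"
      for h :: "real ^ 'n \<Rightarrow> real ^ 'n" and q A
      using measurable_sets[OF similarity_measurable[of h q], of A] that by simp
    have "\<exists>g q. good g q \<and> (a * \<rho>' \<le> q \<and> q \<le> \<rho>' \<or> \<rho>' < q \<and> q \<le> b ^ n)" for n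
    proof (induction n)
      case 0
      have "0 < emeasure \<mu> B"
        using z \<rho> unfolding topological_support_def B_def by simp
      then have "0 < measure \<mu> B" by (simp add: emeasure_eq_measure)
      then have "good id 1" by (simp add: good_def)
      then show ?case using \<rho>' by (metis power_0 order_refl)
    next
      case (Suc n)
      then obtain g q where g: "good g q" and q: "a * \<rho>' \<le> q \<and> q \<le> \<rho>' \<or> \<rho>' < q \<and> q \<le> b ^ n"
        by blast
      show ?case
      proof (cases "a * \<rho>' \<le> q \<and> q \<le> \<rho>'")
        case True
        then show ?thesis using g by blast
      next
        case False
        then have q: "\<rho>' < q" "q \<le> b ^ n" using q by auto
        have gB: "g -` B \<in> sets borel" using g by (intro vim[of g q]) (auto simp: good_def B_def)
        have "\<exists>i<m. 0 < measure \<mu> (f i -` (g -` B))"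
        proof (rule ccontr)
          assume "\<not> ?thesis"
          then have "measure \<mu> (f i -` (g -` B)) = 0" if "i < m" for i
            using that by (metis measure_nonneg less_eq_real_def)
          then have "measure \<mu> (g -` B) = 0" using inv[OF gB] by simp
          then show False using g by (simp add: good_def)
        qed
        then obtain i where i: "i < m" "0 < measure \<mu> (f i -` (g -` B))" by blast
        have "good (g \<circ> f i) (q * c i)"
          unfolding good_def
        proof (intro conjI allI ballI impI)
          show "dist ((g \<circ> f i) x) ((g \<circ> f i) y) = q * c i * dist x y" for x y
            using g f[OF i(1)] by (simp add: good_def)
          show "0 < measure \<mu> ((g \<circ> f i) -` B)" using i by (simp add: vimage_comp)
          fix A :: "(real ^ 'n) set" assume A: "A \<in> sets borel" "measure \<mu> A = 0"
          then have "measure \<mu> (g -` A) = 0" using g by (simp add: good_def)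
          moreover have "g -` A \<in> sets borel" using g A by (intro vim[of g q]) (auto simp: good_def)
          ultimately have "(\<Sum>i<m. p i * measure \<mu> (f i -` (g -` A))) = 0" using inv by simp
          then have "p i * measure \<mu> (f i -` (g -` A)) = 0"
            using i(1) by (subst (asm) sum_nonneg_eq_0_iff) (auto intro!: mult_nonneg_nonneg less_imp_le[OF p(1)])
          then show "measure \<mu> ((g \<circ> f i) -` A) = 0" using p(1)[OF i(1)] by (simp add: vimage_comp)
        qed
        moreover have "a * \<rho>' \<le> q * c i"
          using mult_mono[of a "c i" \<rho>' q] ab(1) ab(3)[OF i(1)] q \<rho>' by (simp add: mult.commute)
        moreover have "q * c i \<le> b ^ Suc n"
          using mult_mono[of "c i" b q "b ^ n"] ab(1) ab(3,4)[OF i(1)] q \<rho>' \<open>0 < b\<close>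
          by (simp add: mult.commute)
        ultimately show ?thesis by (meson not_le)
      qed
    qed
    moreover obtain n where "b ^ n < \<rho>'" using real_arch_pow_inv[OF \<rho>'(1) ab(2)] by blast
    ultimately obtain g q where g: "good g q" and q: "a * \<rho>' \<le> q" "q \<le> \<rho>'" by (meson le_less_trans less_asym)
    have gB: "g -` B \<in> sets borel" using g by (intro vim[of g q]) (auto simp: good_def B_def)
    have q0: "0 < q" using q ab \<rho>' by (meson less_le_trans mult_pos_pos)
    obtain y where y: "y \<in> cball 0 R" "g y \<in> B"
    proof (rule ccontr)
      assume "\<not> thesis"
      with that have "g -` B \<subseteq> space \<mu> - cball 0 R" by (auto simp: sp)
      then have "measure \<mu> (g -` B) \<le> measure \<mu> (space \<mu> - cball 0 R)"
        by (intro finite_measure_mono) (auto simp: sets sp)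
      also have "\<dots> = 0" using R by (subst prob_compl) (auto simp: sets)
      finally show False using g by (simp add: good_def)
    qed
    have "cball 0 R \<subseteq> g -` cball z (\<rho> / 2)"
    proof
      fix w :: "real ^ 'n" assume "w \<in> cball 0 R"
      then have "dist y w \<le> 2 * R" using y dist_triangle[of y w 0] by (simp add: dist_commute)
      then have "dist (g y) (g w) \<le> \<rho>' * (2 * R)"
        using g q q0 R by (auto simp: good_def intro!: mult_mono)
      also have "\<rho>' * (2 * R) \<le> \<rho> / 4" using \<rho> R by (simp add: \<rho>'_def field_simps)
      finally have "dist z (g w) \<le> \<rho> / 2"
        using y dist_triangle[of z "g w" "g y"] by (simp add: B_def)
      then show "w \<in> g -` cball z (\<rho> / 2)" by simp
    qed
    then have "1 \<le> measure \<mu> (g -` cball z (\<rho> / 2))"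
      unfolding R(2)[symmetric]
    proof (rule finite_measure_mono)
      show "g -` cball z (\<rho> / 2) \<in> events"
        unfolding sets using g by (intro vim[of g q]) (auto simp: good_def)
    qed
    then have "measure \<mu> (g -` cball z (\<rho> / 2)) = 1"
      using prob_le_1 by (simp add: antisym)
    moreover have "a / (8 * R + 1) * \<rho> \<le> q" using q by (simp add: \<rho>'_def)
    ultimately show "\<exists>g q. a / (8 * R + 1) * \<rho> \<le> q \<and> (\<forall>x y. dist (g x) (g y) = q * dist x y) \<and>
      (\<forall>A\<in>sets borel. measure \<mu> A = 0 \<longrightarrow> measure \<mu> (g -` A) = 0) \<and>
      measure \<mu> (g -` cball z (\<rho> / 2)) = 1"
      using g unfolding good_def by blast
  qed
qed

text \<open>Egorov-type uniformity: for \<open>s < D\<close> the bound \<open>v powr s\<close> for the mass of balls holds below a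
  common radius on a set of positive measure. The set is measurable because it is closed.\<close>

lemma exact_dimension_frostman_set:
  fixes \<mu> :: "(real ^ 'n) measure"
  assumes "prob_space \<mu>" and sets: "sets \<mu> = sets borel" and dim: "has_exact_dimension \<mu> D"
    and s: "0 < s" "s < D"
  obtains F \<tau> where "F \<in> sets borel" "0 < measure \<mu> F" "0 < \<tau>" "\<tau> \<le> 1"
    "\<And>a v. a \<in> F \<Longrightarrow> 0 < v \<Longrightarrow> v < \<tau> \<Longrightarrow> measure \<mu> (sup_cball a v) \<le> v powr s"
proof -
  interpret prob_space \<mu> by fact
  have sp: "space \<mu> = UNIV" using sets_eq_imp_space_eq[OF sets] by simp
  define F where "F j = {a. \<forall>v. 0 < v \<and> v < inverse (real (Suc j)) \<longrightarrow> measure \<mu> (sup_cball a v) \<le> v powr s}" for j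
  have "closed (F j)" for j
    unfolding closed_sequential_limits
  proof (intro allI impI, elim conjE)
    fix X l assume X: "\<forall>n. X n \<in> F j" "X \<longlonglongrightarrow> l"
    show "l \<in> F j"
      unfolding F_def
    proof (intro CollectI allI impI, elim conjE)
      fix v assume v: "0 < v" "v < inverse (real (Suc j))"
      have "eventually (\<lambda>w. measure \<mu> (sup_cball l v) \<le> w powr s) (at_right v)"
      proof -
        have "measure \<mu> (sup_cball l v) \<le> w powr s" if w: "v < w" "w < inverse (real (Suc j))" for w
        proof -
          have "(\<lambda>n. infnorm (l - X n)) \<longlonglongrightarrow> infnorm (l - l)"
            using X by (intro tendsto_intros)
          then have "eventually (\<lambda>n. infnorm (l - X n) < w - v) sequentially"
            using w by (intro order_tendstoD) (auto simp: infnorm_0)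
          then obtain n where "infnorm (l - X n) < w - v" by (auto simp: eventually_sequentially)
          then have "measure \<mu> (sup_cball l v) \<le> measure \<mu> (sup_cball (X n) w)"
            using sup_cball_triangle[of l "X n" "w - v" v] by (intro finite_measure_mono) (auto simp: sets)
          also have "\<dots> \<le> w powr s" using X(1) w v by (auto simp: F_def)
          finally show ?thesis .
        qed
        then show ?thesis using v eventually_at_right[of v] by blast
      qed
      moreover have "((\<lambda>w. w powr s) \<longlongrightarrow> v powr s) (at_right v)"
        using v by (intro tendsto_intros) auto
      ultimately show "measure \<mu> (sup_cball l v) \<le> v powr s"
        by (intro tendsto_lowerbound) auto
    qed
  qed
  then have Fm: "F j \<in> sets borel" for j by (rule borel_closed)
  have "\<exists>j. 0 < measure \<mu> (F j)"
  proof (rule ccontr)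
    assume "\<not> ?thesis"
    then have "measure \<mu> (F j) = 0" for j
      using measure_nonneg[of \<mu> "F j"] by (auto simp: not_less intro: antisym)
    then have "AE x in \<mu>. x \<notin> F j" for j
      using Fm by (intro AE_not_in) (auto simp: null_sets_def sets emeasure_eq_measure)
    then have "AE x in \<mu>. \<forall>j. x \<notin> F j" by (simp add: AE_all_countable)
    then have "AE x in \<mu>. False"
      using dim unfolding has_exact_dimension_def
    proof eventually_elim
      case (elim x)
      have "eventually (\<lambda>v. ln (measure \<mu> (sup_cball x v)) / ln v > s) (at_right 0)"
        using elim(2) s by (intro order_tendstoD)
      then obtain e where e: "0 < e" "\<And>v. 0 < v \<Longrightarrow> v < e \<Longrightarrow> ln (measure \<mu> (sup_cball x v)) / ln v > s"
        by (auto simp: eventually_at_right_field)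
      obtain j where j: "inverse (real (Suc j)) < min e 1"
        using reals_Archimedean[of "min e 1"] e by auto
      have "x \<in> F j"
        unfolding F_def
      proof (intro CollectI allI impI, elim conjE)
        fix v assume v: "0 < v" "v < inverse (real (Suc j))"
        then have v1: "v < e" "v < 1" using j by auto
        \<comment> \<open>the null case is separate because \<open>ln 0 = 0\<close>\<close>
        show "measure \<mu> (sup_cball x v) \<le> v powr s"
        proof (cases "measure \<mu> (sup_cball x v) = 0")
          case False
          then have pos: "0 < measure \<mu> (sup_cball x v)" by (simp add: zero_less_measure_iff)
          have "ln (measure \<mu> (sup_cball x v)) < s * ln v"
            using e(2)[OF v(1) v1(1)] v v1 by (simp add: less_divide_eq)
          then have "exp (ln (measure \<mu> (sup_cball x v))) < exp (s * ln v)" by simp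
          then show ?thesis using pos v by (simp add: powr_def)
        qed simp
      qed
      with elim(1) show ?case by blast
    qed
    then show False by simp
  qed
  then obtain j where "0 < measure \<mu> (F j)" by blast
  moreover have "inverse (real (Suc j)) \<le> 1" by (rule inverse_le_1_iff[THEN iffD2]) auto
  moreover have "measure \<mu> (sup_cball a v) \<le> v powr s"
    if "a \<in> F j" "0 < v" "v < inverse (real (Suc j))" for a v
    using that unfolding F_def by blast
  ultimately show ?thesis
    by (intro that[of "F j" "inverse (real (Suc j))"] Fm) auto
qed

text \<open>The measure on \<open>cball z \<rho>\<close> is the image under a small copy map \<open>g\<close> of \<open>\<mu>\<close> restricted to a set
  \<open>F\<close> with uniform decay. As the ratio of \<open>g\<close> is at least proportional to \<open>\<rho>\<close>, the decay is
  uniform after rescaling by \<open>\<rho>\<close>.\<close>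

lemma self_similar_frostman:
  fixes \<mu> :: "(real ^ 'n) measure"
  assumes ss: "self_similar_measure \<mu>" and dim: "has_exact_dimension \<mu> D" and s: "0 < s" "s < D"
  obtains \<kappa> C where "0 < \<kappa>" "0 < C"
    "\<And>z \<rho>. z \<in> topological_support \<mu> \<Longrightarrow> 0 < \<rho> \<Longrightarrow> \<rho> \<le> 1 \<Longrightarrow>
      \<exists>m. sets m = sets borel \<and> (\<forall>A\<in>sets borel. emeasure \<mu> A = 0 \<longrightarrow> emeasure m A = 0) \<and>
          ennreal \<kappa> \<le> emeasure m (cball z (\<rho> / 2)) \<and>
          (\<forall>y v. 0 < v \<longrightarrow> emeasure m (cball y v) \<le> ennreal (C * (v / \<rho>) powr s))"
proof -
  have "prob_space \<mu>" and sets [measurable_cong]: "sets \<mu> = sets borel"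
    using ss by (auto simp: self_similar_measure_def)
  interpret prob_space \<mu> by fact
  have sp: "space \<mu> = UNIV" using sets_eq_imp_space_eq[OF sets] by simp
  obtain F \<tau> where F: "F \<in> sets borel" "0 < measure \<mu> F" and \<tau>: "0 < \<tau>" "\<tau> \<le> 1"
    and Fd: "\<And>a v. a \<in> F \<Longrightarrow> 0 < v \<Longrightarrow> v < \<tau> \<Longrightarrow> measure \<mu> (sup_cball a v) \<le> v powr s"
    by (rule exact_dimension_frostman_set[OF \<open>prob_space \<mu>\<close> sets dim s]) blast
  note [measurable] = F(1)
  obtain a0 where a0: "0 < a0" and copy: "\<And>z \<rho>. z \<in> topological_support \<mu> \<Longrightarrow> 0 < \<rho> \<Longrightarrow> \<rho> \<le> 1 \<Longrightarrow>
    \<exists>g q. a0 * \<rho> \<le> q \<and> (\<forall>x y. dist (g x) (g y) = q * dist x y) \<and>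
      (\<forall>A\<in>sets borel. measure \<mu> A = 0 \<longrightarrow> measure \<mu> (g -` A) = 0) \<and>
      measure \<mu> (g -` cball z (\<rho> / 2)) = 1"
    by (rule self_similar_copy[OF ss]) blast
  define C where "C = (2 / (\<tau> * a0)) powr s"
  show ?thesis
  proof (rule that[of "measure \<mu> F" C])
    show "0 < measure \<mu> F" by fact
    show "0 < C" using \<tau> a0 by (simp add: C_def)
    fix z \<rho> assume "z \<in> topological_support \<mu>" and \<rho>: "0 < \<rho>" "\<rho> \<le> (1 :: real)"
    from copy[OF this] obtain g q where q: "a0 * \<rho> \<le> q" and g: "\<And>x y. dist (g x) (g y) = q * dist x y"
      and null: "\<And>A. A \<in> sets borel \<Longrightarrow> measure \<mu> A = 0 \<Longrightarrow> measure \<mu> (g -` A) = 0"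
      and one: "measure \<mu> (g -` cball z (\<rho> / 2)) = 1"
      by blast
    have q0: "0 < q" using q a0 \<rho> by (meson less_le_trans mult_pos_pos)
    have gm [measurable]: "g \<in> borel_measurable borel" using g by (rule similarity_measurable)
    have gA: "g -` A \<in> sets borel" if "A \<in> sets borel" for A
      using measurable_sets[OF gm that] by simp
    define m where "m = distr (density \<mu> (indicator F)) borel g"
    have em: "emeasure m A = ennreal (measure \<mu> (F \<inter> g -` A))" if "A \<in> sets borel" for A
    proof -
      have "emeasure m A = emeasure (density \<mu> (indicator F)) (g -` A)"
        using that by (simp add: m_def emeasure_distr sp)
      also have "\<dots> = emeasure \<mu> (F \<inter> g -` A)"
        using gA[OF that] F by (subst emeasure_density) (auto simp: sets simp flip: indicator_inter_arith)
      finally show ?thesis by (simp add: emeasure_eq_measure)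
    qed
    show "\<exists>m. sets m = sets borel \<and> (\<forall>A\<in>sets borel. emeasure \<mu> A = 0 \<longrightarrow> emeasure m A = 0) \<and>
          ennreal (measure \<mu> F) \<le> emeasure m (cball z (\<rho> / 2)) \<and>
          (\<forall>y v. 0 < v \<longrightarrow> emeasure m (cball y v) \<le> ennreal (C * (v / \<rho>) powr s))"
    proof (intro exI[of _ m] conjI ballI allI impI)
      show "sets m = sets borel" by (simp add: m_def)
      show "emeasure m A = 0" if A: "A \<in> sets borel" "emeasure \<mu> A = 0" for A
      proof -
        have "measure \<mu> (F \<inter> g -` A) \<le> measure \<mu> (g -` A)"
          using gA[OF A(1)] by (intro finite_measure_mono) (auto simp: sets)
        also have "\<dots> = 0" using null A by (simp add: emeasure_eq_measure)
        finally have "measure \<mu> (F \<inter> g -` A) = 0" by (intro antisym measure_nonneg)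
        then show ?thesis using em A(1) by simp
      qed
      have "measure \<mu> F \<le> measure \<mu> (F \<inter> g -` cball z (\<rho> / 2)) + measure \<mu> (space \<mu> - g -` cball z (\<rho> / 2))"
        using gA[of "cball z (\<rho> / 2)"] F
        by (intro order.trans[OF finite_measure_mono measure_Un_le]) (auto simp: sets sp)
      also have "measure \<mu> (space \<mu> - g -` cball z (\<rho> / 2)) = 0"
        using one gA[of "cball z (\<rho> / 2)"] by (subst prob_compl) (auto simp: sets)
      finally show "ennreal (measure \<mu> F) \<le> emeasure m (cball z (\<rho> / 2))"
        by (simp add: em ennreal_leI)
      fix y :: "real ^ 'n" and v :: real assume v: "0 < v"
      have "measure \<mu> (F \<inter> g -` cball y v) \<le> (2 / (\<tau> * a0) * (v / \<rho>)) powr s"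
      proof (cases "F \<inter> g -` cball y v = {}")
        case False
        \<comment> \<open>recentre the ball at a point of \<open>F\<close>, which doubles its radius\<close>
        then obtain a where a: "a \<in> F" "dist y (g a) \<le> v" by auto
        have "g -` cball y v \<subseteq> cball a (2 * v / q)"
        proof
          fix w assume "w \<in> g -` cball y v"
          then have "dist (g a) (g w) \<le> 2 * v"
            using a dist_triangle[of "g a" "g w" y] by (simp add: dist_commute)
          then show "w \<in> cball a (2 * v / q)" using g q0 by (simp add: field_simps)
        qed
        also have "\<dots> \<subseteq> sup_cball a (2 * v / q)" by (rule cball_subset_sup_cball)
        finally have sub: "F \<inter> g -` cball y v \<subseteq> sup_cball a (2 * v / q)" by blast
        have le: "2 * v / q \<le> \<tau> * (2 / (\<tau> * a0) * (v / \<rho>))"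
        proof -
          have "2 * v / q \<le> 2 * v / (a0 * \<rho>)"
            using q v a0 \<rho> q0 by (intro divide_left_mono) auto
          then show ?thesis using \<tau> by simp
        qed
        show ?thesis
        proof (cases "2 * v / q < \<tau>")
          case True
          have "measure \<mu> (F \<inter> g -` cball y v) \<le> measure \<mu> (sup_cball a (2 * v / q))"
            using sub by (intro finite_measure_mono) (auto simp: sets)
          also have "\<dots> \<le> (2 * v / q) powr s" using Fd[OF a(1) _ True] v q0 by simp
          also have "\<dots> \<le> (2 / (\<tau> * a0) * (v / \<rho>)) powr s"
          proof (rule powr_mono2)
            have "\<tau> * (2 / (\<tau> * a0) * (v / \<rho>)) \<le> 1 * (2 / (\<tau> * a0) * (v / \<rho>))"
              using \<tau> a0 v \<rho> by (intro mult_right_mono) auto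
            then show "2 * v / q \<le> 2 / (\<tau> * a0) * (v / \<rho>)" using le by linarith
          qed (use s v q0 in auto)
          finally show ?thesis .
        next
          case False
          then have "\<tau> * 1 \<le> \<tau> * (2 / (\<tau> * a0) * (v / \<rho>))" using le by linarith
          then have "1 \<le> 2 / (\<tau> * a0) * (v / \<rho>)" using \<tau> mult_le_cancel_left_pos by blast
          then have "1 \<le> (2 / (\<tau> * a0) * (v / \<rho>)) powr s" using s by (intro ge_one_powr_ge_zero) auto
          then show ?thesis using prob_le_1[of "F \<inter> g -` cball y v"] by linarith
        qed
      qed simp
      also have "\<dots> = C * (v / \<rho>) powr s"
        using \<tau> a0 v \<rho> by (subst powr_mult) (auto simp: C_def)
      finally show "emeasure m (cball y v) \<le> ennreal (C * (v / \<rho>) powr s)"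
        by (simp add: em ennreal_leI)
    qed
  qed
qed

section \<open>Lower bound for the Hausdorff dimension\<close>

lemma measure_dim_eq:
  fixes \<mu> :: "(real ^ 'n) measure"
  assumes "prob_space \<mu>" "has_exact_dimension \<mu> D"
  shows "measure_dim \<mu> = D"
proof -
  interpret prob_space \<mu> by fact
  have "D' = D" if "has_exact_dimension \<mu> D'" for D'
  proof -
    have "AE x in \<mu>. D' = D"
      using that assms(2) unfolding has_exact_dimension_def
    proof eventually_elim
      case (elim x)
      then show ?case by (intro tendsto_unique[OF _ elim]) simp
    qed
    then show ?thesis by simp
  qed
  with assms(2) have "(THE D. has_exact_dimension \<mu> D) = D" by (rule the_equality)
  then show ?thesis
    using assms(2) unfolding measure_dim_def by metis
qed

lemma hausdorff_measure_zero_cover: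
  assumes "hausdorff_measure s A = 0" "0 < e"
  shows "\<exists>U :: nat \<Rightarrow> _. (\<forall>i. bounded (U i)) \<and> A \<subseteq> (\<Union>i. U i) \<and>
    (\<Sum>i. ennreal (sup_diameter (U i) powr s)) < e"
proof -
  have "hausdorff_premeasure s 1 A \<le> hausdorff_measure s A"
    unfolding hausdorff_measure_def by (intro SUP_upper) auto
  then have "hausdorff_premeasure s 1 A < e" using assms by simp
  then show ?thesis
    unfolding hausdorff_premeasure_def Inf_less_iff by blast
qed

text \<open>The content bound is Euclidean. With \<open>\<Lambda>\<close> the square root of the dimension of the space, a
  supremum-norm ball of radius \<open>r\<close> lies between the Euclidean balls of radii \<open>r\<close> and \<open>\<Lambda> * r\<close>, and
  distances within a set are at most \<open>\<Lambda>\<close> times its diameter in the supremum norm.\<close>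

lemma hausdorff_dim_limsup_ge:
  fixes \<mu> :: "(real ^ 'n) measure" and x :: "nat \<Rightarrow> real ^ 'n" and r :: "nat \<Rightarrow> real"
  assumes ss: "self_similar_measure \<mu>" and dim: "has_exact_dimension \<mu> D"
    and r: "\<And>n. 0 < r n" "r \<longlonglongrightarrow> 0" and x: "\<And>n. x n \<in> topological_support \<mu>"
    and full: "measure \<mu> (\<Inter>g. \<Union>n\<in>{g..}. sup_cball (x n) (r n)) = 1" and \<delta>: "1 \<le> \<delta>"
  shows "ereal (D / \<delta>) \<le> hausdorff_dim (\<Inter>g. \<Union>n\<in>{g..}. contracted_cball \<delta> (x n) (r n))"
  unfolding hausdorff_dim_def
proof (rule Inf_greatest, safe)
  fix t assume t: "0 < t"
    and H: "hausdorff_measure t (\<Inter>g. \<Union>n\<in>{g..}. contracted_cball \<delta> (x n) (r n)) = 0"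
  have "prob_space \<mu>" and sets: "sets \<mu> = sets borel"
    using ss by (auto simp: self_similar_measure_def)
  interpret prob_space \<mu> by fact
  have sp: "space \<mu> = UNIV" using sets_eq_imp_space_eq[OF sets] by simp
  define \<Lambda> where "\<Lambda> = sqrt (real CARD('n))"
  have \<Lambda>: "1 \<le> \<Lambda>" by (simp add: \<Lambda>_def)
  have "D / \<delta> \<le> t"
  proof (rule ccontr)
    assume "\<not> ?thesis"
    then have "\<delta> * t < D" using \<delta> by (simp add: field_simps)
    then obtain s where s: "\<delta> * t < s" "s < D" using dense by blast
    have "0 < \<delta> * t" using t \<delta> by simp
    then have "0 < s" using s by linarith
    obtain \<kappa> C where \<kappa>C: "0 < \<kappa>" "0 < C" and frostman:
      "\<And>z \<rho>. z \<in> topological_support \<mu> \<Longrightarrow> 0 < \<rho> \<Longrightarrow> \<rho> \<le> 1 \<Longrightarrow>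
      \<exists>m. sets m = sets borel \<and> (\<forall>A\<in>sets borel. emeasure \<mu> A = 0 \<longrightarrow> emeasure m A = 0) \<and>
          ennreal \<kappa> \<le> emeasure m (cball z (\<rho> / 2)) \<and>
          (\<forall>y v. 0 < v \<longrightarrow> emeasure m (cball y v) \<le> ennreal (C * (v / \<rho>) powr s))"
      by (rule self_similar_frostman[OF ss dim \<open>0 < s\<close> s(2)]) blast
    let ?L = "\<Inter>g. \<Union>n\<in>{g..}. cball (x n) (\<Lambda> * r n)"
    have Lm: "?L \<in> sets \<mu>" unfolding sets by measurable
    have "(\<Inter>g. \<Union>n\<in>{g..}. sup_cball (x n) (r n)) \<subseteq> ?L"
      using sup_cball_subset_cball unfolding \<Lambda>_def by blast
    then have "1 \<le> measure \<mu> ?L"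
      unfolding full[symmetric] using Lm by (rule finite_measure_mono)
    then have "measure \<mu> (space \<mu> - ?L) = 0"
      using prob_compl[OF Lm] prob_le_1[of ?L] by linarith
    then have "emeasure \<mu> (- ?L) = 0"
      by (simp add: emeasure_eq_measure sp Compl_eq_Diff_UNIV)
    from content_lower_bound[OF x r this \<kappa>C frostman t \<delta> s(1) \<Lambda>]
    obtain c where c_content: "0 < c \<and> (\<forall>(U :: nat \<Rightarrow> (real ^ 'n) set) u. (\<forall>i. 0 < u i) \<longrightarrow>
       (\<forall>i. \<forall>p\<in>U i. \<forall>q\<in>U i. dist p q \<le> u i) \<longrightarrow>
       (\<Inter>g. \<Union>n\<in>{g..}. cball (x n) (r n powr \<delta>)) \<subseteq> (\<Union>i. U i) \<longrightarrow>
       ennreal c \<le> (\<Sum>i. ennreal (u i powr t)))"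
      by (rule exE)
    note c = c_content[THEN conjunct1]
    note content = c_content[THEN conjunct2, rule_format]
    define e where "e = c / 2 / \<Lambda> powr t"
    have "0 < e" using c \<Lambda> by (simp add: e_def)
    then have "0 < ennreal e" by simp
    from hausdorff_measure_zero_cover[OF H this]
    obtain U :: "nat \<Rightarrow> (real ^ 'n) set" where U_all: "(\<forall>i. bounded (U i)) \<and>
      (\<Inter>g. \<Union>n\<in>{g..}. contracted_cball \<delta> (x n) (r n)) \<subseteq> (\<Union>i. U i) \<and>
      (\<Sum>i. ennreal (sup_diameter (U i) powr t)) < ennreal e"
      by (rule exE)
    note U = U_all[THEN conjunct1, rule_format] U_all[THEN conjunct2, THEN conjunct1]
      U_all[THEN conjunct2, THEN conjunct2]
    \<comment> \<open>the terms \<open>w i\<close>, of sum \<open>c / 4\<close>, make all diameter bounds positive\<close>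
    define w where "w i = c / 4 * (1 / 2) ^ Suc i" for i
    define u where "u i = max (\<Lambda> * sup_diameter (U i)) (w i powr (1 / t))" for i
    have w0: "0 < w i" for i using c by (simp add: w_def)
    have "ennreal c \<le> (\<Sum>i. ennreal (u i powr t))"
    proof (rule content)
      show "0 < u i" for i using w0[of i] by (simp add: u_def less_max_iff_disj)
      show "dist p q \<le> u i" if "p \<in> U i" "q \<in> U i" for i p q
      proof -
        have "dist p q \<le> \<Lambda> * infnorm (p - q)"
          using norm_le_infnorm[of "p - q"] by (simp add: \<Lambda>_def dist_norm)
        also have "\<dots> \<le> \<Lambda> * sup_diameter (U i)"
          using \<Lambda> infnorm_le_sup_diameter[OF U(1) that] by (intro mult_left_mono) auto
        finally show ?thesis by (simp add: u_def)
      qed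
      have "(\<Inter>g. \<Union>n\<in>{g..}. cball (x n) (r n powr \<delta>)) \<subseteq>
        (\<Inter>g. \<Union>n\<in>{g..}. contracted_cball \<delta> (x n) (r n))"
        using cball_subset_sup_cball unfolding contracted_cball_def by blast
      with U(2) show "(\<Inter>g. \<Union>n\<in>{g..}. cball (x n) (r n powr \<delta>)) \<subseteq> (\<Union>i. U i)" by blast
    qed
    also have "\<dots> \<le> (\<Sum>i. ennreal (\<Lambda> powr t) * ennreal (sup_diameter (U i) powr t) + ennreal (w i))"
    proof (rule suminf_le)
      fix i
      have "u i powr t \<le> \<Lambda> powr t * sup_diameter (U i) powr t + w i"
      proof (cases "\<Lambda> * sup_diameter (U i) \<le> w i powr (1 / t)")
        case True
        then show ?thesis using t w0[of i] by (simp add: u_def powr_powr)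
      next
        case False
        then show ?thesis
          using t w0[of i] \<Lambda> sup_diameter_nonneg[OF U(1)[of i]] by (simp add: u_def powr_mult)
      qed
      then show "ennreal (u i powr t) \<le> ennreal (\<Lambda> powr t) * ennreal (sup_diameter (U i) powr t) + ennreal (w i)"
        using w0[of i] by (simp add: ennreal_leI flip: ennreal_mult ennreal_plus)
    qed auto
    also have "\<dots> = ennreal (\<Lambda> powr t) * (\<Sum>i. ennreal (sup_diameter (U i) powr t)) + (\<Sum>i. ennreal (w i))"
      by (subst suminf_add[symmetric]) auto
    also have "(\<Sum>i. ennreal (w i)) = ennreal (c / 4)"
    proof -
      have "w sums (c / 4)" using sums_mult[OF power_half_series, of "c / 4"] unfolding w_def by (simp only: mult_1_right)
      then show ?thesis using w0 by (intro suminf_ennreal_eq) (auto intro: less_imp_le)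
    qed
    also have "ennreal (\<Lambda> powr t) * (\<Sum>i. ennreal (sup_diameter (U i) powr t)) + ennreal (c / 4)
      \<le> ennreal (\<Lambda> powr t) * ennreal e + ennreal (c / 4)"
      using U(3) by (intro add_mono mult_left_mono) auto
    also have "\<dots> = ennreal (3 * c / 4)"
      using c \<Lambda> by (simp add: e_def flip: ennreal_mult ennreal_plus)
    finally show False using c by simp
  qed
  then show "ereal (D / \<delta>) \<le> ereal t" by simp
qed

section \<open>Upper bound for the Hausdorff dimension\<close>

text \<open>The set \<open>S\<close> selects one index for each ball, since weak redundancy speaks of the set of
  balls while a sequence may repeat a ball. Within one disjoint class of scale \<open>k\<close> the measures
  of the balls sum to at most 1, hence so do the powers \<open>(2 * r n) powr (D + \<epsilon>)\<close>. Two of the three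
  units \<open>\<epsilon>\<close> in \<open>\<delta> * s = D + 3 * \<epsilon>\<close> give the decay \<open>2 powr (- 2 * \<epsilon> * k)\<close>, half of which absorbs the number of
  classes.\<close>

lemma first_occurrences_summable:
  fixes \<mu> :: "(real ^ 'n) measure" and x :: "nat \<Rightarrow> real ^ 'n" and r :: "nat \<Rightarrow> real"
  assumes "prob_space \<mu>" and sets: "sets \<mu> = sets borel"
    and r0: "\<And>n. 0 < r n" and wr: "weakly_redundant x r"
    and \<epsilon>: "0 < \<epsilon>" and dim: "\<delta> * s = D + 3 * \<epsilon>" and D: "0 \<le> D"
    and N0: "\<And>n. N0 \<le> n \<Longrightarrow> r n \<le> 1"
      "\<And>n. N0 \<le> n \<Longrightarrow> (2 * r n) powr (D + \<epsilon>) \<le> measure \<mu> (sup_cball (x n) (r n))"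
  defines "S \<equiv> {n. N0 \<le> n \<and> (\<forall>m\<in>{N0..<n}. (x m, r m) \<noteq> (x n, r n))}"
  shows "emeasure (weight_measure (\<lambda>n. (2 * r n powr \<delta>) powr s)) S < \<infinity>"
proof -
  interpret prob_space \<mu> by fact
  define W where "W = weight_measure (\<lambda>n. (2 * r n powr \<delta>) powr s)"
  obtain J :: "nat \<Rightarrow> nat" and T :: "nat \<Rightarrow> nat \<Rightarrow> (real ^ 'n) set set" where
    JT_all: "\<forall>k. 1 \<le> J k \<and> dyadic_balls x r k = (\<Union>j\<in>{1..J k}. T k j) \<and>
             disjoint_family_on (T k) {1..J k} \<and>
             (\<forall>j\<in>{1..J k}. \<forall>B\<in>T k j. \<forall>B'\<in>T k j. B \<noteq> B' \<longrightarrow> B \<inter> B' = {})"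
    and J: "(\<lambda>k. log 2 (real (J k)) / real k) \<longlonglongrightarrow> 0"
    using wr unfolding weakly_redundant_def by (elim exE conjE)
  have J1: "1 \<le> J k" for k using JT_all[rule_format, of k] by (rule conjunct1)
  have JT: "dyadic_balls x r k = (\<Union>j\<in>{1..J k}. T k j)"
      "\<And>j B B'. j \<in> {1..J k} \<Longrightarrow> B \<in> T k j \<Longrightarrow> B' \<in> T k j \<Longrightarrow> B \<noteq> B' \<Longrightarrow> B \<inter> B' = {}" for k
    using JT_all[rule_format, of k] by auto
  define Sk where "Sk k = {n\<in>S. 2 powr (- real k - 1) < r n \<and> r n \<le> 2 powr (- real k)}" for k
  define c where "c k = 2 powr s * 2 powr (- 2 * \<epsilon> * real k)" for k
  have part: "emeasure W {n\<in>Sk k. sup_cball (x n) (r n) \<in> T k j} \<le> ennreal (c k)" if j: "j \<in> {1..J k}" for k j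
  proof -
    let ?G = "{n\<in>Sk k. sup_cball (x n) (r n) \<in> T k j}"
    have "emeasure W (\<Union>n\<in>?G. {n}) \<le> ennreal (c k) * emeasure \<mu> (\<Union>n\<in>?G. sup_cball (x n) (r n))"
    proof (rule emeasure_UN_le_transfer)
      show "disjoint_family_on (\<lambda>n. sup_cball (x n) (r n)) ?G"
        unfolding disjoint_family_on_def
      proof (intro ballI impI)
        fix n m assume nm: "n \<in> ?G" "m \<in> ?G" "n \<noteq> m"
        then have "(x n, r n) \<noteq> (x m, r m)"
          using linorder_less_linear[of n m] by (auto simp: Sk_def S_def)
        then have "sup_cball (x n) (r n) \<noteq> sup_cball (x m) (r m)"
          using sup_cball_inject[OF r0 r0] by blast
        then show "sup_cball (x n) (r n) \<inter> sup_cball (x m) (r m) = {}"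
          using JT(2)[OF j] nm by blast
      qed
      fix n assume n: "n \<in> ?G"
      then have nN: "N0 \<le> n" and rk: "r n \<le> 2 powr (- real k)" by (auto simp: Sk_def S_def)
      have "(2 * r n powr \<delta>) powr s = 2 powr s * r n powr (D + \<epsilon> + 2 * \<epsilon>)"
        using r0[of n] dim by (simp add: powr_mult powr_powr algebra_simps)
      also have "\<dots> = 2 powr s * r n powr (2 * \<epsilon>) * r n powr (D + \<epsilon>)"
        by (subst powr_add) (simp only: mult_ac)
      also have "\<dots> \<le> c k * measure \<mu> (sup_cball (x n) (r n))"
        unfolding c_def
      proof (intro mult_mono)
        show "r n powr (2 * \<epsilon>) \<le> 2 powr (- 2 * \<epsilon> * real k)"
          using powr_mono2[of "2 * \<epsilon>" "r n" "2 powr (- real k)"] rk r0[of n] \<epsilon>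
          by (simp add: powr_powr mult.commute)
        show "r n powr (D + \<epsilon>) \<le> measure \<mu> (sup_cball (x n) (r n))"
          using N0(2)[OF nN] powr_mono2[of "D + \<epsilon>" "r n" "2 * r n"] r0[of n] \<epsilon> D by simp
      qed auto
      finally show "emeasure W {n} \<le> ennreal (c k) * emeasure \<mu> (sup_cball (x n) (r n))"
        by (simp add: W_def emeasure_eq_measure c_def ennreal_leI flip: ennreal_mult)
    qed (auto simp: W_def sets)
    also have "\<dots> \<le> ennreal (c k) * 1" by (intro mult_left_mono emeasure_le_1) auto
    finally show ?thesis by simp
  qed
  have Sk_le: "emeasure W (Sk k) \<le> ennreal (real (J k) * c k)" for k
  proof -
    have "Sk k \<subseteq> (\<Union>j\<in>{1..J k}. {n\<in>Sk k. sup_cball (x n) (r n) \<in> T k j})"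
    proof
      fix n assume n: "n \<in> Sk k"
      then have "sup_cball (x n) (r n) \<in> dyadic_balls x r k"
        by (auto simp: dyadic_balls_def Sk_def)
      then show "n \<in> (\<Union>j\<in>{1..J k}. {n\<in>Sk k. sup_cball (x n) (r n) \<in> T k j})"
        using JT(1) n by blast
    qed
    then have "emeasure W (Sk k) \<le> emeasure W (\<Union>j\<in>{1..J k}. {n\<in>Sk k. sup_cball (x n) (r n) \<in> T k j})"
      by (intro emeasure_mono) (auto simp: W_def)
    also have "\<dots> \<le> (\<Sum>j\<in>{1..J k}. emeasure W {n\<in>Sk k. sup_cball (x n) (r n) \<in> T k j})"
      by (intro emeasure_subadditive_finite) (auto simp: W_def)
    also have "\<dots> \<le> (\<Sum>j\<in>{1..J k}. ennreal (c k))" by (intro sum_mono part)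
    also have "\<dots> = ennreal (real (J k) * c k)"
      by (simp add: c_def ennreal_mult ennreal_of_nat_eq_real_of_nat)
    finally show ?thesis .
  qed
  have S_sub: "S \<subseteq> (\<Union>k. Sk k)"
  proof
    fix n assume n: "n \<in> S"
    then have "r n \<le> 1" using N0 by (auto simp: S_def)
    define k where "k = nat \<lfloor>- log 2 (r n)\<rfloor>"
    have "0 \<le> - log 2 (r n)" using r0[of n] \<open>r n \<le> 1\<close> by simp
    then have k: "real k \<le> - log 2 (r n)" "- log 2 (r n) < real k + 1"
      by (auto simp: k_def)
    have "r n = 2 powr (log 2 (r n))" using r0[of n] by simp
    moreover have "2 powr (- real k - 1) < (2 powr (log 2 (r n)) :: real)" using k by simp
    moreover have "(2 powr (log 2 (r n)) :: real) \<le> 2 powr (- real k)" using k by simp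
    ultimately show "n \<in> (\<Union>k. Sk k)" using n by (auto simp: Sk_def)
  qed
  have "summable (\<lambda>k. real (J k) * c k)"
  proof (rule summable_comparison_test_ev)
    have "eventually (\<lambda>k. log 2 (real (J k)) / real k < \<epsilon>) sequentially"
      using J \<epsilon> by (rule order_tendstoD)
    then show "eventually (\<lambda>k. norm (real (J k) * c k) \<le> 2 powr s * (2 powr (- \<epsilon>)) ^ k) sequentially"
      using eventually_gt_at_top[of 0]
    proof eventually_elim
      case (elim k)
      then have "log 2 (real (J k)) \<le> \<epsilon> * real k" by (simp add: field_simps)
      then have "real (J k) \<le> 2 powr (\<epsilon> * real k)"
        using J1[of k] by (subst (asm) log_le_iff) auto
      then have "real (J k) * c k \<le> 2 powr (\<epsilon> * real k) * (2 powr s * 2 powr (- 2 * \<epsilon> * real k))"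
        unfolding c_def by (intro mult_right_mono) auto
      also have "\<dots> = 2 powr s * (2 powr (\<epsilon> * real k) * 2 powr (- 2 * \<epsilon> * real k))" by simp
      also have "(2 powr (\<epsilon> * real k) * 2 powr (- 2 * \<epsilon> * real k) :: real) = 2 powr (- \<epsilon> * real k)"
        by (simp flip: powr_add)
      also have "(2 powr (- \<epsilon> * real k) :: real) = (2 powr (- \<epsilon>)) ^ k"
        by (simp add: powr_powr flip: powr_realpow)
      finally show ?case by (simp add: c_def)
    qed
    have "(2 :: real) powr (- \<epsilon>) < 2 powr 0" using \<epsilon> by (intro powr_less_mono) auto
    then show "summable (\<lambda>k. 2 powr s * (2 powr (- \<epsilon>)) ^ k)"
      by (intro summable_mult summable_geometric) auto
  qed
  then have fin: "(\<Sum>k. ennreal (real (J k) * c k)) \<noteq> \<infinity>"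
    by (simp add: c_def suminf_ennreal2)
  have "emeasure W S \<le> emeasure W (\<Union>k. Sk k)"
    using S_sub by (intro emeasure_mono) (auto simp: W_def)
  also have "\<dots> \<le> (\<Sum>k. emeasure W (Sk k))"
    by (intro emeasure_subadditive_countably) (auto simp: W_def)
  also have "\<dots> \<le> (\<Sum>k. ennreal (real (J k) * c k))" by (intro suminf_le Sk_le) auto
  finally show ?thesis using fin by (auto simp: W_def less_top[symmetric] top_unique)
qed

text \<open>A tail of the selected contracted balls still covers the limsup set: every ball of small radius
  has its first occurrence late in the sequence.\<close>

lemma hausdorff_measure_limsup_eq_0:
  fixes x :: "nat \<Rightarrow> real ^ 'n" and r :: "nat \<Rightarrow> real" and N0 :: nat
  assumes r: "\<And>n. 0 < r n" "r \<longlonglongrightarrow> 0" and exps: "0 < s" "1 \<le> \<delta>"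
  defines "S \<equiv> {n. N0 \<le> n \<and> (\<forall>m\<in>{N0..<n}. (x m, r m) \<noteq> (x n, r n))}"
  assumes fin: "emeasure (weight_measure (\<lambda>n. (2 * r n powr \<delta>) powr s)) S < \<infinity>"
  shows "hausdorff_measure s (\<Inter>g. \<Union>n\<in>{g..}. contracted_cball \<delta> (x n) (r n)) = 0"
proof -
  define W where "W = weight_measure (\<lambda>n. (2 * r n powr \<delta>) powr s)"
  let ?E = "\<Inter>g. \<Union>n\<in>{g..}. contracted_cball \<delta> (x n) (r n)"
  have tail: "(\<lambda>N. emeasure W (S \<inter> {N..})) \<longlonglongrightarrow> emeasure W (\<Inter>N. S \<inter> {N..})"
  proof (rule Lim_emeasure_decseq)
    have "emeasure W (S \<inter> {N..}) \<le> emeasure W S" for N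
      by (intro emeasure_mono) (auto simp: W_def)
    then show "emeasure W (S \<inter> {N..}) \<noteq> \<infinity>" for N
      using fin by (metis W_def leD)
  qed (auto simp: W_def decseq_def)
  have "(\<Inter>N. S \<inter> {N..}) = {}"
  proof (rule equals0I)
    fix n assume "n \<in> (\<Inter>N. S \<inter> {N..})"
    then have "n \<in> S \<inter> {Suc n..}" by blast
    then show False by simp
  qed
  with tail have tail0: "(\<lambda>N. emeasure W (S \<inter> {N..})) \<longlonglongrightarrow> 0" by simp
  have "hausdorff_premeasure s e ?E \<le> 0" if e: "0 < e" for e
  proof (rule LIMSEQ_le_const[OF tail0])
    have "(\<lambda>n. 2 * r n powr \<delta>) \<longlonglongrightarrow> 2 * 0 powr \<delta>"
      using r exps by (intro tendsto_intros tendsto_powr2) (auto simp: less_imp_le)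
    then have "eventually (\<lambda>n. 2 * r n powr \<delta> < e) sequentially"
      using e exps by (intro order_tendstoD) auto
    then obtain N1 where N1: "\<And>n. N1 \<le> n \<Longrightarrow> 2 * r n powr \<delta> < e"
      by (auto simp: eventually_sequentially)
    show "\<exists>N1. \<forall>N\<ge>N1. hausdorff_premeasure s e ?E \<le> emeasure W (S \<inter> {N..})"
    proof (intro exI[of _ N1] allI impI)
      fix N assume N: "N1 \<le> N"
      define U where "U n = (if n \<in> S \<inter> {N..} then contracted_cball \<delta> (x n) (r n) else {})" for n
      have diam: "sup_diameter (U n) = (if n \<in> S \<inter> {N..} then 2 * r n powr \<delta> else 0)" for n
        by (simp add: U_def contracted_cball_def sup_diameter_sup_cball sup_diameter_def[of "{}"])
      have "?E \<subseteq> (\<Union>n. U n)"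
      proof
        fix y assume y: "y \<in> ?E"
        have "eventually (\<lambda>n. r n < r m) sequentially" for m
          using r by (intro order_tendstoD) auto
        then have "eventually (\<lambda>n. \<forall>m\<in>{..<N}. r n < r m) sequentially"
          by (intro eventually_ball_finite) auto
        then obtain N2 where N2: "\<And>n m. N2 \<le> n \<Longrightarrow> m < N \<Longrightarrow> r n < r m"
          by (auto simp: eventually_sequentially)
        obtain n where n: "max N0 N2 \<le> n" "y \<in> contracted_cball \<delta> (x n) (r n)"
          using y by blast
        define k where "k = (LEAST k. N0 \<le> k \<and> (x k, r k) = (x n, r n))"
        have k: "N0 \<le> k" "(x k, r k) = (x n, r n)"
          using LeastI[of "\<lambda>k. N0 \<le> k \<and> (x k, r k) = (x n, r n)" n] n unfolding k_def by auto
        have "k \<in> S"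
          unfolding S_def
        proof (intro CollectI conjI ballI notI)
          fix m assume "m \<in> {N0..<k}" "(x m, r m) = (x k, r k)"
          then have "m < k" "N0 \<le> m \<and> (x m, r m) = (x n, r n)" using k by auto
          then show False unfolding k_def by (blast dest: not_less_Least)
        qed (rule k)
        moreover have "N \<le> k" using N2[of n k] n k by (cases "k < N") auto
        ultimately show "y \<in> (\<Union>n. U n)" using n k by (auto simp: U_def)
      qed
      moreover have "bounded (U n)" for n
        by (simp add: U_def contracted_cball_def bounded_sup_cball)
      moreover have "sup_diameter (U n) \<le> e" for n
        using N1[of n] N e by (auto simp: diam intro: less_imp_le)
      ultimately have "hausdorff_premeasure s e ?E \<le> (\<Sum>n. ennreal (sup_diameter (U n) powr s))"
        unfolding hausdorff_premeasure_def by (intro Inf_lower) blast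
      also have "\<dots> = emeasure W (S \<inter> {N..})"
        unfolding W_def emeasure_weight_measure
        by (intro suminf_cong) (auto simp: diam indicator_def)
      finally show "hausdorff_premeasure s e ?E \<le> emeasure W (S \<inter> {N..})" .
    qed
  qed
  then have "hausdorff_premeasure s e ?E = 0" if "0 < e" for e using that by simp
  then show ?thesis unfolding hausdorff_measure_def by (intro antisym SUP_least) auto
qed

lemma hausdorff_dim_limsup_le:
  fixes \<mu> :: "(real ^ 'n) measure" and x :: "nat \<Rightarrow> real ^ 'n" and r :: "nat \<Rightarrow> real"
  assumes prob: "prob_space \<mu>" and sets: "sets \<mu> = sets borel"
    and r: "\<And>n. 0 < r n" "r \<longlonglongrightarrow> 0" and x: "\<And>n. x n \<in> topological_support \<mu>"
    and wr: "weakly_redundant x r" and \<delta>: "1 \<le> \<delta>"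
    and limsup: "limsup (\<lambda>n. ereal (ln (measure \<mu> (sup_cball (x n) (r n))) / ln (2 * r n))) = ereal D"
  shows "hausdorff_dim (\<Inter>g. \<Union>n\<in>{g..}. contracted_cball \<delta> (x n) (r n)) \<le> ereal (D / \<delta>)"
proof -
  interpret prob_space \<mu> by fact
  let ?E = "\<Inter>g. \<Union>n\<in>{g..}. contracted_cball \<delta> (x n) (r n)"
  let ?q = "\<lambda>n. ln (measure \<mu> (sup_cball (x n) (r n))) / ln (2 * r n)"
  have pos: "0 < measure \<mu> (sup_cball (x n) (r n))" for n
  proof -
    have "0 < emeasure \<mu> (ball (x n) (r n))"
      using x[of n] r(1)[of n] by (auto simp: topological_support_def)
    also have "\<dots> \<le> emeasure \<mu> (sup_cball (x n) (r n))"
      using cball_subset_sup_cball[of "x n" "r n"] ball_subset_cball[of "x n" "r n"]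
      by (intro emeasure_mono) (auto simp: sets)
    finally show ?thesis by (simp add: emeasure_eq_measure)
  qed
  have small: "eventually (\<lambda>n. r n < 1 / 2) sequentially"
    using r(2) by (intro order_tendstoD) auto
  have D: "0 \<le> D"
  proof -
    have "eventually (\<lambda>n. 0 \<le> ereal (?q n)) sequentially"
      using small
    proof eventually_elim
      case (elim n)
      have "ln (measure \<mu> (sup_cball (x n) (r n))) \<le> 0" using pos[of n] prob_le_1 by simp
      moreover have "ln (2 * r n) \<le> 0" using elim r(1)[of n] by simp
      ultimately show ?case by (simp add: divide_nonpos_nonpos)
    qed
    then have "0 \<le> limsup (\<lambda>n. ereal (?q n))"
      by (intro le_Limsup) auto
    then show ?thesis using limsup by simp
  qed
  have zero: "hausdorff_measure s ?E = 0" if s: "D / \<delta> < s" "0 < s" for s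
  proof -
    define \<epsilon> where "\<epsilon> = (\<delta> * s - D) / 3"
    have \<epsilon>: "0 < \<epsilon>" using s \<delta> by (simp add: \<epsilon>_def field_simps)
    have "eventually (\<lambda>n. ereal (?q n) < ereal (D + \<epsilon>)) sequentially"
      using limsup \<epsilon> by (intro Limsup_lessD) simp
    then have "eventually (\<lambda>n. r n \<le> 1 \<and>
        (2 * r n) powr (D + \<epsilon>) \<le> measure \<mu> (sup_cball (x n) (r n))) sequentially"
      using small
    proof eventually_elim
      case (elim n)
      have "ln (2 * r n) < 0" using elim r(1)[of n] by simp
      then have "(D + \<epsilon>) * ln (2 * r n) < ln (measure \<mu> (sup_cball (x n) (r n)))"
        using elim by (simp add: divide_less_eq)
      then have "exp ((D + \<epsilon>) * ln (2 * r n)) < exp (ln (measure \<mu> (sup_cball (x n) (r n))))" by simp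
      then show ?case using pos[of n] r(1)[of n] elim by (simp add: powr_def)
    qed
    then obtain N0 where N0: "\<And>n. N0 \<le> n \<Longrightarrow> r n \<le> 1"
      "\<And>n. N0 \<le> n \<Longrightarrow> (2 * r n) powr (D + \<epsilon>) \<le> measure \<mu> (sup_cball (x n) (r n))"
      by (auto simp: eventually_sequentially)
    have "\<delta> * s = D + 3 * \<epsilon>" by (simp add: \<epsilon>_def field_simps)
    from hausdorff_measure_limsup_eq_0[OF r s(2) \<delta> first_occurrences_summable[OF prob sets r(1) wr \<epsilon> this D N0]]
    show ?thesis .
  qed
  show ?thesis
  proof (rule ccontr)
    assume "\<not> ?thesis"
    then obtain s where s: "ereal (D / \<delta>) < ereal s" "ereal s < hausdorff_dim ?E"
      using ereal_dense2[of "ereal (D / \<delta>)" "hausdorff_dim ?E"] by (auto simp: not_le)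
    have "0 \<le> D / \<delta>" using D \<delta> by simp
    then have "0 < s" using s(1) by simp
    then have "hausdorff_dim ?E \<le> ereal s"
      unfolding hausdorff_dim_def using zero s(1) by (intro Inf_lower) auto
    with s(2) show False by simp
  qed
qed

section \<open>The dimension of the limsup set\<close>

theorem corollary2p9:
  fixes \<mu> :: "(real ^ 'n) measure"
    and x :: "nat \<Rightarrow> real ^ 'n" and r :: "nat \<Rightarrow> real"
    and B :: "nat \<Rightarrow> (real ^ 'n) set"
  defines "B \<equiv> \<lambda>n. sup_cball (x n) (r n)"
  assumes "self_similar_measure \<mu>"
    and "\<And>n. 0 < r n"
    and "\<And>n. x n \<in> topological_support \<mu>"
    and "(\<lambda>n. sup_diameter (B n)) \<longlonglongrightarrow> 0"
    and "measure \<mu> (\<Inter>g. \<Union>n\<in>{g..}. B n) = 1"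
  shows "(\<forall>\<delta>\<ge>1. hausdorff_dim (\<Inter>g. \<Union>n\<in>{g..}. contracted_cball \<delta> (x n) (r n))
                  \<ge> ereal (measure_dim \<mu> / \<delta>)) \<and>
         (weakly_redundant x r \<and>
          limsup (\<lambda>n. ereal (ln (measure \<mu> (B n)) / ln (sup_diameter (B n))))
            = ereal (measure_dim \<mu>) \<longrightarrow>
          (\<forall>\<delta>\<ge>1. hausdorff_dim (\<Inter>g. \<Union>n\<in>{g..}. contracted_cball \<delta> (x n) (r n))
                  = ereal (measure_dim \<mu> / \<delta>)))"
proof -
  have ss: "self_similar_measure \<mu>" and r0: "\<And>n. 0 < r n"
    and x: "\<And>n. x n \<in> topological_support \<mu>" by fact+
  have prob: "prob_space \<mu>" and sets: "sets \<mu> = sets borel"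
    using ss by (auto simp: self_similar_measure_def)
  have diam: "sup_diameter (B n) = 2 * r n" for n
    using r0[of n] by (simp add: B_def sup_diameter_sup_cball)
  have "(\<lambda>n. 2 * r n / 2) \<longlonglongrightarrow> 0 / 2"
    using assms(5) unfolding diam by (intro tendsto_divide tendsto_const) auto
  then have r: "r \<longlonglongrightarrow> 0" by simp
  have full: "measure \<mu> (\<Inter>g. \<Union>n\<in>{g..}. sup_cball (x n) (r n)) = 1"
    using assms(6) unfolding B_def .
  have ge: "ereal (measure_dim \<mu> / \<delta>) \<le> hausdorff_dim (\<Inter>g. \<Union>n\<in>{g..}. contracted_cball \<delta> (x n) (r n))"
    if "1 \<le> \<delta>" for \<delta>
  proof (cases "\<exists>D. has_exact_dimension \<mu> D")
    case True
    then obtain D where "has_exact_dimension \<mu> D" by blast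
    then show ?thesis
      using hausdorff_dim_limsup_ge[OF ss _ r0 r x full that] measure_dim_eq[OF prob] by metis
  next
    case False
    \<comment> \<open>here \<open>measure_dim \<mu> = 0\<close>, and a Hausdorff dimension is nonnegative\<close>
    then show ?thesis
      by (auto simp: measure_dim_def hausdorff_dim_def intro!: Inf_greatest)
  qed
  moreover have "hausdorff_dim (\<Inter>g. \<Union>n\<in>{g..}. contracted_cball \<delta> (x n) (r n)) \<le> ereal (measure_dim \<mu> / \<delta>)"
    if "weakly_redundant x r" "1 \<le> \<delta>"
      "limsup (\<lambda>n. ereal (ln (measure \<mu> (B n)) / ln (sup_diameter (B n)))) = ereal (measure_dim \<mu>)" for \<delta>
    using that(3) unfolding diam unfolding B_def
    by (rule hausdorff_dim_limsup_le[OF prob sets r0 r x that(1,2)])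
  ultimately show ?thesis by (blast intro: antisym)
qed

end
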